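(* Let $k\ge0$ be an integer. Assume $$\eta>\frac{C_{\rm tr}^2N_\partial}{4\epsilon}$$ for some real number $0<\epsilon<1$. Then, for all $\underline{v}_h\in\underline{V}_{h,0}^k$, $$C_{\rm stab}\,\|\underline{v}_h\|_{{\rm en},h}^2\le a_h(\underline{v}_h,\underline{v}_h),\qquad C_{\rm stab}:=\min\Big\{1-\epsilon,\ \eta-\frac{C_{\rm tr}^2N_\partial}{4\epsilon}\Big\}.$$
   Context: **Domain.** $\Omega\subset\mathbb{R}^2$ is an open bounded connected polygonal domain; $\Gamma\subset\Omega$ is a closed non-self-intersecting polygonal chain with $\Gamma\cap\partial\Omega=\emptyset$, partitioning $\Omega$ into an internal and an external polygonal subdomain $\Omega_{\rm int}$, $\Omega_{\rm ext}$. $\bullet$ stands for int or ext. The diffusion coefficient $\sigma$ equals constants $\sigma_{\rm int}>0$ in $\Omega_{\rm int}$ and $\sigma_{\rm ext}>0$ in $\Omega_{\rm ext}$. **Mesh.** $\mathcal{T}_h$ is a finite set of disjoint open polygonal elements whose closures cover $\overline{\Omega}$; $\mathcal{E}_h$ is a finite set of disjoint open straight edges whose closures cover $\bigcup_T\partial T$, each edge being contained either in $\partial T_1\cap\partial T_2$ for two distinct elements or in $\partial T\cap\partial\Omega$ for one element; $\mathcal{V}_h$ is the set of edge endpoints, with $x_V$ the coordinates of $V$. The mesh is fitted to the interface: there is $\mathcal{E}_{\Gamma,h}\subset\mathcal{E}_h$ with $\Gamma=\bigcup_{E\in\mathcal{E}_{\Gamma,h}}\overline{E}$. $\mathcal{T}_h^\bullet:=\{T\in\mathcal{T}_h: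 T\subset\Omega_\bullet\}$; $\mathcal{E}_h^\bullet$, $\mathcal{V}_h^\bullet$ are the edges and vertices of elements of $\mathcal{T}_h^\bullet$. $\mathcal{E}_T$ is the set of edges of $T$. $h_X$ is the diameter of $X$. Each $E$ has a fixed unit normal $n_E$; $\omega_{TE}\in\{-1,1\}$ is such that $\omega_{TE}n_E$ points out of $T$. The mesh belongs to a regular sequence with regularity parameter $\varrho\in(0,1)$: there is a conforming triangulation subdividing every element and edge of the mesh such that each triangle $\tau$ has inradius $\ge\varrho h_\tau$ and $h_\tau\ge\varrho h_T$ whenever $\tau\subset T$. For each $T$, $x_T\in T$ is a point whose distance from $\partial T$ is comparable to $h_T$. **Polynomials.** $\mathcal{P}^m(X)$: restrictions to $X$ of polynomials of total degree $\le m$, $\mathcal{P}^{-1}(X):=\{0\}$; $\pi^m_X$ is the $L^2$-orthogonal projector onto it; $\mathcal{R}^{{\rm c},m}(T):=(x-x_T)\mathcal{P}^{m-1}(T)$. **Discrete space.** $\underline{V}^k_{\bullet,h}$ is the set of $\underline{v}_h=((v_T)_{T\in\mathcal{T}_h^\bullet},(v_E)_{E\in\mathcal{E}_h^\bullet},(v_V)_{V\in\mathcal{V}_h^\bullet})$ with $v_T\in\mathcal{P}^{k-1}(T)$, $v_E\in\mathcal{P}^{k-1}(E)$, $v_V\in\mathbb{R}$; $\underline{V}_h^k:=\underline{V}^k_{{\rm int},h}\times\underline{V}^k_{{\rm ext},h}$ (so unknowns on $\Gamma$ are doubled); $\underline{V}^k_{h,0}$ is its subspace with edge and vertex values vanishing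 on $\partial\Omega$. $\underline{V}_T^k,\underline{v}_T$ denote restrictions to $T$ (components on $T$ and its boundary, from the subdomain containing $T$). **Reconstructions.** For $E\in\mathcal{E}_T$, $v_{TE}\in\mathcal{P}^{k+1}(E)$ is the unique polynomial with $v_{TE}(x_V)=v_V$ at the endpoints $V$ of $E$ and $\pi_E^{k-1}v_{TE}=v_E$ (components taken from $\underline{v}_T$). $G_T^k:\underline{V}_T^k\to\mathcal{P}^k(T)^2$ and $p_T^{k+1}:\underline{V}_T^k\to\mathcal{P}^{k+1}(T)$ are defined by $\int_T G_T^k\underline{v}_T\cdot\tau=-\int_Tv_T\nabla\cdot\tau+\sum_{E\in\mathcal{E}_T}\omega_{TE}\int_Ev_{TE}(\tau\cdot n_E)$ for all $\tau\in\mathcal{P}^k(T)^2$, and $\int_Tp_T^{k+1}\underline{v}_T\,\nabla\cdot\tau=-\int_TG_T^k\underline{v}_T\cdot\tau+\sum_{E\in\mathcal{E}_T}\omega_{TE}\int_Ev_{TE}(\tau\cdot n_E)$ for all $\tau\in\mathcal{R}^{{\rm c},k+2}(T)$. $(G_h^k\underline{v}_h)_{|T}:=G_T^k\underline{v}_T$. **Interface operators.** For $E\in\mathcal{E}_{\Gamma,h}$, $T_{\rm int}\in\mathcal{T}_h^{\rm int}$, $T_{\rm ext}\in\mathcal{T}_h^{\rm ext}$ are the elements sharing $E$. $\lambda_{\rm int}:=\frac{\sigma_{\rm ext}}{\sigma_{\rm int}+\sigma_{\rm ext}}$, $\lambda_{\rm ext}:=\frac{\sigma_{\rm int}}{\sigma_{\rm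 int}+\sigma_{\rm ext}}$, $\alpha:=\frac{2\sigma_{\rm int}\sigma_{\rm ext}}{\sigma_{\rm int}+\sigma_{\rm ext}}$. $[\underline{v}_h]_E:=v_{T_{\rm int}E}-v_{T_{\rm ext}E}$; for a vector field $\Psi$, $\{\Psi\}_{k,E}:=\lambda_{\rm int}\Psi_{|T_{\rm int}}+\lambda_{\rm ext}\Psi_{|T_{\rm ext}}$ (traces on $E$). **Bilinear form.** With $\sigma_T:=\sigma_{|T}$ and penalty parameter $\eta$, $a_h(\underline{w}_h,\underline{v}_h):=\sum_{T\in\mathcal{T}_h}\big(\int_T\sigma_TG_T^k\underline{w}_T\cdot G_T^k\underline{v}_T+\frac{\sigma_T}{h_T}\sum_{E\in\mathcal{E}_T}\int_E(p_T^{k+1}\underline{w}_T-w_{TE})(p_T^{k+1}\underline{v}_T-v_{TE})\big)-\sum_{E\in\mathcal{E}_{\Gamma,h}}\int_E\{\sigma G_h^k\underline{w}_h\}_{k,E}\cdot n_E[\underline{v}_h]_E+\eta\sum_{E\in\mathcal{E}_{\Gamma,h}}\frac{\alpha}{h_E}\int_E[\underline{w}_h]_E[\underline{v}_h]_E$. **Norms and constants.** $|\underline{v}_h|_{{\rm J},h}^2:=\sum_{E\in\mathcal{E}_{\Gamma,h}}\frac{\alpha}{h_E}\|[\underline{v}_h]_E\|_{L^2(E)}^2$ and $\|\underline{v}_h\|_{{\rm en},h}^2:=\sum_{T}\sigma_T\big(\|G_T^k\underline{v}_T\|_{L^2(T)^2}^2+h_T^{-1}\sum_{E\in\mathcal{E}_T}\|p_T^{k+1}\underline{v}_T-v_{TE}\|_{L^2(E)}^2\big)+|\underline{v}_h|_{{\rm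 J},h}^2$. $C_{\rm tr}$ is a constant depending only on $k$ and $\varrho$ such that $\|\varphi\|_{L^2(E)}\le C_{\rm tr}h_E^{-1/2}\|\varphi\|_{L^2(T)}$ for all $T\in\mathcal{T}_h$, $E\in\mathcal{E}_T$, $\varphi\in\mathcal{P}^k(T)$. $N_\partial:=\max_{T\in\mathcal{T}_h}\operatorname{card}(\mathcal{E}_T\cap\mathcal{E}_{\Gamma,h})$. *)

theory Defs
  imports "HOL-Analysis.Analysis"
begin

type_synonym point = "real^2"

text \<open>
  A (possibly non-convex, possibly multiply connected) open polygon: a connected set that is the
  interior of a finite union of closed, non-degenerate triangles.  Such a set is bounded, and it is
  the interior of its closure, so that slits are excluded.
\<close>

definition polygonal_domain :: "point set \<Rightarrow> bool" where
  "polygonal_domain S \<longleftrightarrow> S \<noteq> {} \<and> connected S \<and>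
     (\<exists>F. finite F \<and> (\<forall>\<tau>\<in>F. 2 simplex \<tau>) \<and> S = interior (\<Union>F))"

fun chain_path :: "point \<Rightarrow> point list \<Rightarrow> (real \<Rightarrow> point)" where
  "chain_path p [] = linepath p p"
| "chain_path p [q] = linepath p q"
| "chain_path p (q # r # ps) = linepath p q +++ chain_path q (r # ps)"

definition simple_closed_chain :: "point set \<Rightarrow> bool" where
  "simple_closed_chain \<Gamma> \<longleftrightarrow>
     (\<exists>p ps. simple_path (chain_path p (ps @ [p])) \<and> \<Gamma> = path_image (chain_path p (ps @ [p])))"

definition inradius :: "point set \<Rightarrow> real" where
  "inradius \<tau> = Sup {r. 0 \<le> r \<and> (\<exists>x. ball x r \<subseteq> \<tau>)}"

definition straight_edge :: "point set \<Rightarrow> bool" where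
  "straight_edge E \<longleftrightarrow> (\<exists>a b. a \<noteq> b \<and> E = open_segment a b)"

definition edge_ends :: "point set \<Rightarrow> point \<times> point" where
  "edge_ends E = (SOME (a, b). a \<noteq> b \<and> E = open_segment a b)"

definition endpoints :: "point set \<Rightarrow> point set" where
  "endpoints E = {fst (edge_ends E), snd (edge_ends E)}"

text \<open>
  The vector \<open>\<nu>\<close>, normal to the edge \<open>E\<close> of \<open>T\<close>, points out of \<open>T\<close>.  Finitely many points of \<open>E\<close> are
  exempted because another corner of \<open>T\<close> may touch \<open>E\<close> from the opposite side.
\<close>

definition points_out :: "point set \<Rightarrow> point set \<Rightarrow> point \<Rightarrow> bool" where
  "points_out T E \<nu> \<longleftrightarrow> finite {x \<in> E. \<not> (\<forall>\<^sub>F t in at_right 0. x + t *\<^sub>R \<nu> \<notin> T)}"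

datatype side = Internal | External

record interface_mesh =
  domain :: "point set"
  interface :: "point set"
  diffusion :: "side \<Rightarrow> real"
  elements :: "point set set"
  edges :: "point set set"
  interface_edges :: "point set set"
  normal :: "point set \<Rightarrow> point"
  centre :: "point set \<Rightarrow> point"

fun subdomain :: "interface_mesh \<Rightarrow> side \<Rightarrow> point set" where
  "subdomain M Internal = domain M \<inter> inside (interface M)"
| "subdomain M External = domain M \<inter> outside (interface M)"

definition edges_of :: "interface_mesh \<Rightarrow> point set \<Rightarrow> point set set" where
  "edges_of M T = {E \<in> edges M. E \<subseteq> frontier T}"

definition elements_in :: "interface_mesh \<Rightarrow> side \<Rightarrow> point set set" where
  "elements_in M s = {T \<in> elements M. T \<subseteq> subdomain M s}"

definition edges_in :: "interface_mesh \<Rightarrow> side \<Rightarrow> point set set" where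
  "edges_in M s = (\<Union>T\<in>elements_in M s. edges_of M T)"

definition vertices_in :: "interface_mesh \<Rightarrow> side \<Rightarrow> point set" where
  "vertices_in M s = (\<Union>E\<in>edges_in M s. endpoints E)"

definition orientation :: "interface_mesh \<Rightarrow> point set \<Rightarrow> point set \<Rightarrow> real" where
  "orientation M T E = (THE \<omega>. \<omega> \<in> {-1, 1} \<and> points_out T E (\<omega> *\<^sub>R normal M E))"

definition interface_setting :: "interface_mesh \<Rightarrow> bool" where
  "interface_setting M \<longleftrightarrow>
     polygonal_domain (domain M) \<and>
     simple_closed_chain (interface M) \<and>
     interface M \<subseteq> domain M \<and> interface M \<inter> frontier (domain M) = {} \<and>
     (\<forall>s. polygonal_domain (subdomain M s)) \<and>
     (\<forall>s. diffusion M s > 0)"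

definition polygonal_mesh :: "interface_mesh \<Rightarrow> bool" where
  "polygonal_mesh M \<longleftrightarrow>
     finite (elements M) \<and> (\<forall>T\<in>elements M. polygonal_domain T) \<and>
     pairwise disjnt (elements M) \<and>
     (\<Union>T\<in>elements M. closure T) = closure (domain M) \<and>
     finite (edges M) \<and> (\<forall>E\<in>edges M. straight_edge E) \<and>
     pairwise disjnt (edges M) \<and>
     (\<Union>E\<in>edges M. closure E) = (\<Union>T\<in>elements M. frontier T) \<and>
     (\<forall>E\<in>edges M.
        (\<exists>T1\<in>elements M. \<exists>T2\<in>elements M. T1 \<noteq> T2 \<and> E \<subseteq> frontier T1 \<inter> frontier T2) \<or>
        (\<exists>T\<in>elements M. E \<subseteq> frontier T \<inter> frontier (domain M))) \<and>
     (\<forall>E\<in>edges M. norm (normal M E) = 1 \<and> (\<forall>x\<in>E. \<forall>y\<in>E. (y - x) \<bullet> normal M E = 0)) \<and>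
     (\<forall>T\<in>elements M. centre M T \<in> T) \<and>
     (\<exists>c>0. \<forall>T\<in>elements M. c * diameter T \<le> infdist (centre M T) (frontier T))"

definition interface_fitted :: "interface_mesh \<Rightarrow> bool" where
  "interface_fitted M \<longleftrightarrow>
     interface_edges M \<subseteq> edges M \<and> interface M = (\<Union>E\<in>interface_edges M. closure E)"

text \<open>
  Elements are open and simplices are closed, hence a triangle of the submesh lies in an element
  when it is contained in the closure of that element.
\<close>

definition mesh_regularity :: "interface_mesh \<Rightarrow> real \<Rightarrow> bool" where
  "mesh_regularity M \<rho> \<longleftrightarrow> 0 < \<rho> \<and> \<rho> < 1 \<and>
     (\<exists>S. triangulation S \<and> (\<forall>\<tau>\<in>S. 2 simplex \<tau>) \<and>
        (\<forall>\<tau>\<in>S. \<exists>T\<in>elements M. \<tau> \<subseteq> closure T) \<and>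
        (\<forall>T\<in>elements M. closure T = \<Union>{\<tau> \<in> S. \<tau> \<subseteq> closure T}) \<and>
        (\<forall>E\<in>edges M. closure E =
           \<Union>{e. e \<subseteq> closure E \<and> 1 simplex e \<and> (\<exists>\<tau>\<in>S. e face_of \<tau>)}) \<and>
        (\<forall>\<tau>\<in>S. \<rho> * diameter \<tau> \<le> inradius \<tau>) \<and>
        (\<forall>\<tau>\<in>S. \<forall>T\<in>elements M. \<tau> \<subseteq> closure T \<longrightarrow> \<rho> * diameter T \<le> diameter \<tau>))"

definition regular_interface_mesh :: "interface_mesh \<Rightarrow> real \<Rightarrow> bool" where
  "regular_interface_mesh M \<rho> \<longleftrightarrow>
     interface_setting M \<and> polygonal_mesh M \<and> interface_fitted M \<and> mesh_regularity M \<rho>"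

definition element_integral :: "point set \<Rightarrow> (point \<Rightarrow> real) \<Rightarrow> real" where
  "element_integral T f = (LINT x:T|lborel. f x)"

definition edge_integral :: "point set \<Rightarrow> (point \<Rightarrow> real) \<Rightarrow> real" where
  "edge_integral E f =
     (case edge_ends E of (a, b) \<Rightarrow> dist a b * (LINT t:{0..1}|lborel. f (a + t *\<^sub>R (b - a))))"

definition element_norm :: "point set \<Rightarrow> (point \<Rightarrow> 'b::real_normed_vector) \<Rightarrow> real" where
  "element_norm T f = sqrt (element_integral T (\<lambda>x. (norm (f x))\<^sup>2))"

definition edge_norm :: "point set \<Rightarrow> (point \<Rightarrow> 'b::real_normed_vector) \<Rightarrow> real" where
  "edge_norm E f = sqrt (edge_integral E (\<lambda>x. (norm (f x))\<^sup>2))"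

text \<open>Polynomials of total degree at most \<open>m\<close>; only the zero function if \<open>m < 0\<close>.\<close>

definition polynomials :: "int \<Rightarrow> (point \<Rightarrow> real) set" where
  "polynomials m = {p. \<exists>c :: nat \<Rightarrow> nat \<Rightarrow> real. \<forall>x.
     p x = (\<Sum>(i, j) | int (i + j) \<le> m. c i j * (x $ 1) ^ i * (x $ 2) ^ j)}"

text \<open>
  The space of polynomials on an open element or edge \<open>X\<close>.  A function on \<open>X\<close> is represented by its
  continuous extension to the closure of \<open>X\<close>, so that evaluating it on the edges of an element, or
  at the endpoints of an edge, gives its trace.  The value \<open>0\<close> off the closure of \<open>X\<close> is a mere
  normalisation, which makes the representation unique.
\<close>

definition polys_on :: "int \<Rightarrow> point set \<Rightarrow> (point \<Rightarrow> real) set" where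
  "polys_on m X = (\<lambda>p x. if x \<in> closure X then p x else 0) ` polynomials m"

definition vector_polys_on :: "int \<Rightarrow> point set \<Rightarrow> (point \<Rightarrow> point) set" where
  "vector_polys_on m X = {\<tau>. \<forall>i. (\<lambda>x. \<tau> x $ i) \<in> polys_on m X}"

definition radial_polys_on :: "interface_mesh \<Rightarrow> int \<Rightarrow> point set \<Rightarrow> (point \<Rightarrow> point) set" where
  "radial_polys_on M m T = (\<lambda>q x. q x *\<^sub>R (x - centre M T)) ` polys_on (m - 1) T"

definition edge_projection :: "int \<Rightarrow> point set \<Rightarrow> (point \<Rightarrow> real) \<Rightarrow> (point \<Rightarrow> real)" where
  "edge_projection m E f =
     (THE p. p \<in> polys_on m E \<and>
        (\<forall>q\<in>polys_on m E. edge_integral E (\<lambda>x. (f x - p x) * q x) = 0))"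

definition divergence :: "(point \<Rightarrow> point) \<Rightarrow> point \<Rightarrow> real" where
  "divergence \<tau> x = (\<Sum>i\<in>UNIV. frechet_derivative \<tau> (at x) (axis i 1) $ i)"

record dofs =
  elem_dof :: "point set \<Rightarrow> (point \<Rightarrow> real)"
  edge_dof :: "point set \<Rightarrow> (point \<Rightarrow> real)"
  vert_dof :: "point \<Rightarrow> real"

definition side_space :: "interface_mesh \<Rightarrow> nat \<Rightarrow> side \<Rightarrow> dofs set" where
  "side_space M k s = {v.
     elem_dof v \<in> (\<Pi>\<^sub>E T\<in>elements_in M s. polys_on (int k - 1) T) \<and>
     edge_dof v \<in> (\<Pi>\<^sub>E E\<in>edges_in M s. polys_on (int k - 1) E) \<and>
     vert_dof v \<in> (\<Pi>\<^sub>E V\<in>vertices_in M s. UNIV)}"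

definition vanishes_on_boundary :: "interface_mesh \<Rightarrow> side \<Rightarrow> dofs \<Rightarrow> bool" where
  "vanishes_on_boundary M s v \<longleftrightarrow>
     (\<forall>E\<in>edges_in M s. E \<subseteq> frontier (domain M) \<longrightarrow> (\<forall>x\<in>E. edge_dof v E x = 0)) \<and>
     (\<forall>V\<in>vertices_in M s. V \<in> frontier (domain M) \<longrightarrow> vert_dof v V = 0)"

definition discrete_space :: "interface_mesh \<Rightarrow> nat \<Rightarrow> (dofs \<times> dofs) set" where
  "discrete_space M k = side_space M k Internal \<times> side_space M k External"

definition discrete_space0 :: "interface_mesh \<Rightarrow> nat \<Rightarrow> (dofs \<times> dofs) set" where
  "discrete_space0 M k = {v \<in> discrete_space M k.
     vanishes_on_boundary M Internal (fst v) \<and> vanishes_on_boundary M External (snd v)}"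

definition side_of :: "interface_mesh \<Rightarrow> point set \<Rightarrow> side" where
  "side_of M T = (if T \<in> elements_in M Internal then Internal else External)"

text \<open>
  The component of a discrete function that carries the unknowns of \<open>T\<close>; it is passed on to the
  local operators below, which only read its values on \<open>T\<close>, its edges and its vertices.
\<close>

definition local_dofs :: "interface_mesh \<Rightarrow> dofs \<times> dofs \<Rightarrow> point set \<Rightarrow> dofs" where
  "local_dofs M v T = (case side_of M T of Internal \<Rightarrow> fst v | External \<Rightarrow> snd v)"

definition edge_rec :: "nat \<Rightarrow> point set \<Rightarrow> dofs \<Rightarrow> (point \<Rightarrow> real)" where
  "edge_rec k E v =
     (THE p. p \<in> polys_on (int k + 1) E \<and>
        (\<forall>V\<in>endpoints E. p V = vert_dof v V) \<and>
        edge_projection (int k - 1) E p = edge_dof v E)"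

definition boundary_term ::
  "interface_mesh \<Rightarrow> nat \<Rightarrow> point set \<Rightarrow> dofs \<Rightarrow> (point \<Rightarrow> point) \<Rightarrow> real" where
  "boundary_term M k T v \<tau> =
     (\<Sum>E\<in>edges_of M T. orientation M T E *
        edge_integral E (\<lambda>x. edge_rec k E v x * (\<tau> x \<bullet> normal M E)))"

definition gradient_rec :: "interface_mesh \<Rightarrow> nat \<Rightarrow> point set \<Rightarrow> dofs \<Rightarrow> (point \<Rightarrow> point)" where
  "gradient_rec M k T v =
     (THE G. G \<in> vector_polys_on (int k) T \<and>
        (\<forall>\<tau>\<in>vector_polys_on (int k) T.
           element_integral T (\<lambda>x. G x \<bullet> \<tau> x) =
             - element_integral T (\<lambda>x. elem_dof v T x * divergence \<tau> x)
             + boundary_term M k T v \<tau>))"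

definition potential_rec :: "interface_mesh \<Rightarrow> nat \<Rightarrow> point set \<Rightarrow> dofs \<Rightarrow> (point \<Rightarrow> real)" where
  "potential_rec M k T v =
     (THE p. p \<in> polys_on (int k + 1) T \<and>
        (\<forall>\<tau>\<in>radial_polys_on M (int k + 2) T.
           element_integral T (\<lambda>x. p x * divergence \<tau> x) =
             - element_integral T (\<lambda>x. gradient_rec M k T v x \<bullet> \<tau> x)
             + boundary_term M k T v \<tau>))"

definition element_at :: "interface_mesh \<Rightarrow> side \<Rightarrow> point set \<Rightarrow> point set" where
  "element_at M s E = (THE T. T \<in> elements_in M s \<and> E \<in> edges_of M T)"

fun weight :: "interface_mesh \<Rightarrow> side \<Rightarrow> real" where
  "weight M Internal = diffusion M External / (diffusion M Internal + diffusion M External)"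
| "weight M External = diffusion M Internal / (diffusion M Internal + diffusion M External)"

definition harmonic_mean :: "interface_mesh \<Rightarrow> real" where
  "harmonic_mean M = 2 * diffusion M Internal * diffusion M External /
                     (diffusion M Internal + diffusion M External)"

definition elem_diffusion :: "interface_mesh \<Rightarrow> point set \<Rightarrow> real" where
  "elem_diffusion M T = diffusion M (side_of M T)"

definition jump :: "interface_mesh \<Rightarrow> nat \<Rightarrow> dofs \<times> dofs \<Rightarrow> point set \<Rightarrow> (point \<Rightarrow> real)" where
  "jump M k v E = (\<lambda>x. edge_rec k E (local_dofs M v (element_at M Internal E)) x
                     - edge_rec k E (local_dofs M v (element_at M External E)) x)"

text \<open>Element-wise defined vector fields are families \<open>\<Psi>\<close> indexed by the elements.\<close>

definition average ::
  "interface_mesh \<Rightarrow> (point set \<Rightarrow> point \<Rightarrow> point) \<Rightarrow> point set \<Rightarrow> (point \<Rightarrow> point)" where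
  "average M \<Psi> E = (\<lambda>x. weight M Internal *\<^sub>R \<Psi> (element_at M Internal E) x
                       + weight M External *\<^sub>R \<Psi> (element_at M External E) x)"

definition broken_gradient ::
  "interface_mesh \<Rightarrow> nat \<Rightarrow> dofs \<times> dofs \<Rightarrow> (point set \<Rightarrow> point \<Rightarrow> point)" where
  "broken_gradient M k v = (\<lambda>T. gradient_rec M k T (local_dofs M v T))"

definition residual ::
  "interface_mesh \<Rightarrow> nat \<Rightarrow> dofs \<times> dofs \<Rightarrow> point set \<Rightarrow> point set \<Rightarrow> (point \<Rightarrow> real)" where
  "residual M k v T E = (\<lambda>x. potential_rec M k T (local_dofs M v T) x
                           - edge_rec k E (local_dofs M v T) x)"

definition bilinear_form ::
  "interface_mesh \<Rightarrow> nat \<Rightarrow> real \<Rightarrow> dofs \<times> dofs \<Rightarrow> dofs \<times> dofs \<Rightarrow> real" where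
  "bilinear_form M k \<eta> w v =
     (\<Sum>T\<in>elements M.
        element_integral T (\<lambda>x. elem_diffusion M T *
          (broken_gradient M k w T x \<bullet> broken_gradient M k v T x))
        + elem_diffusion M T / diameter T *
            (\<Sum>E\<in>edges_of M T. edge_integral E (\<lambda>x. residual M k w T E x * residual M k v T E x)))
     - (\<Sum>E\<in>interface_edges M. edge_integral E (\<lambda>x.
          (average M (\<lambda>T y. elem_diffusion M T *\<^sub>R broken_gradient M k w T y) E x \<bullet> normal M E)
          * jump M k v E x))
     + \<eta> * (\<Sum>E\<in>interface_edges M. harmonic_mean M / diameter E *
          edge_integral E (\<lambda>x. jump M k w E x * jump M k v E x))"

definition jump_seminorm :: "interface_mesh \<Rightarrow> nat \<Rightarrow> dofs \<times> dofs \<Rightarrow> real" where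
  "jump_seminorm M k v =
     sqrt (\<Sum>E\<in>interface_edges M. harmonic_mean M / diameter E * (edge_norm E (jump M k v E))\<^sup>2)"

definition energy_norm :: "interface_mesh \<Rightarrow> nat \<Rightarrow> dofs \<times> dofs \<Rightarrow> real" where
  "energy_norm M k v =
     sqrt ((\<Sum>T\<in>elements M. elem_diffusion M T *
              ((element_norm T (broken_gradient M k v T))\<^sup>2
               + inverse (diameter T) *
                   (\<Sum>E\<in>edges_of M T. (edge_norm E (residual M k v T E))\<^sup>2)))
           + (jump_seminorm M k v)\<^sup>2)"

text \<open>
  No uniformity over a mesh sequence is asked of \<open>C\<close>: any constant that is admissible for \<open>M\<close> and \<open>k\<close>
  will do, in particular one that depends only on \<open>k\<close> and the regularity parameter.
\<close>

definition discrete_trace_constant :: "interface_mesh \<Rightarrow> nat \<Rightarrow> real \<Rightarrow> bool" where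
  "discrete_trace_constant M k C \<longleftrightarrow>
     (\<forall>T\<in>elements M. \<forall>E\<in>edges_of M T. \<forall>\<phi>\<in>polys_on (int k) T.
        edge_norm E \<phi> \<le> C * diameter E powr (-1/2) * element_norm T \<phi>)"

definition max_interface_edges :: "interface_mesh \<Rightarrow> nat" where
  "max_interface_edges M = Max ((\<lambda>T. card (edges_of M T \<inter> interface_edges M)) ` elements M)"

end

theory Submission
  imports Defs "HOL-Computational_Algebra.Polynomial"
begin

text \<open>
  Write \<open>S\<close> for the gradient part, \<open>R\<close> for the stabilisation part and \<open>J\<close> for the jump part of the
  squared energy norm.  On the diagonal the bilinear form is \<open>S + R - K + \<eta> J\<close>, where \<open>K\<close> is the
  consistency term, the sum over the interface edges of the integrals of averaged normal flux times
  jump.  It suffices to show \<open>K \<le> \<epsilon> S + C\<^sup>2 N / (4 \<epsilon>) J\<close> (\<open>consistency_bound\<close>), with \<open>C\<close> the trace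
  constant and \<open>N\<close> the maximal number of interface edges of an element.

  On one edge the diffusion-dependent weights of the average reduce the flux to half the harmonic
  mean times the sum of the normal gradients from both sides.  Cauchy--Schwarz, the discrete trace
  inequality and Young's inequality bound the edge contribution (\<open>interface_flux_bound\<close>), uniformly in
  the contrast since half the harmonic mean is at most either coefficient.  In the sum over the
  interface edges each element appears at most \<open>N\<close> times (\<open>sum_element_at_le\<close>).

  Most of the work goes into showing that the objects fixed by definite descriptions exist.
  Applying the trace inequality needs the reconstructed gradient to be a polynomial
  (\<open>gradient_rec_in_polys\<close>), which in turn needs the edge reconstructions to be polynomials
  (\<open>edge_rec_in_polys\<close>); both rest on Riesz representation in finite-dimensional spaces of functions
  (\<open>riesz_representation\<close>).  The potential reconstruction enters only through squares that occur in
  the same way in the bilinear form and in the norm.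

  The other such object is the element adjacent to an interface edge on a given side
  (\<open>interface_edge_neighbours\<close>).  Near a generic point of an edge shared by two disjoint polygons, these
  fill one half-disc each (\<open>adjacent_polygons_fill\<close>).  By the Jordan curve theorem both the inside and
  the outside of the interface accumulate at that point, and each element lies in only one of them;
  so the two elements are on different sides and there is no third.
\<close>

section \<open>Riesz representation on finite spans of functions\<close>

definition fun_span :: "'i set \<Rightarrow> ('i \<Rightarrow> 'a \<Rightarrow> 'b::real_vector) \<Rightarrow> ('a \<Rightarrow> 'b) set" where
  "fun_span I g = {\<lambda>x. \<Sum>i\<in>I. c i *\<^sub>R g i x | c. True}"

lemma fun_span_axpy:
  assumes "f \<in> fun_span I g" "h \<in> fun_span I g"
  shows "(\<lambda>x. f x + c *\<^sub>R h x) \<in> fun_span I g"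
proof -
  obtain u w where "f = (\<lambda>x. \<Sum>i\<in>I. u i *\<^sub>R g i x)" "h = (\<lambda>x. \<Sum>i\<in>I. w i *\<^sub>R g i x)"
    using assms unfolding fun_span_def by blast
  then have "(\<lambda>x. f x + c *\<^sub>R h x) = (\<lambda>x. \<Sum>i\<in>I. (u i + c * w i) *\<^sub>R g i x)"
    by (simp add: scaleR_left_distrib sum.distrib scaleR_sum_right)
  then show ?thesis unfolding fun_span_def
    by (intro CollectI exI[of _ "\<lambda>i. u i + c * w i"]) simp
qed

lemma fun_span_zero: "(\<lambda>x. 0) \<in> fun_span I g"
  unfolding fun_span_def by (intro CollectI exI[of _ "\<lambda>_. 0"]) simp

lemma fun_span_insert:
  assumes "finite I" "j \<notin> I"
  shows "f \<in> fun_span (insert j I) g \<longleftrightarrow> (\<exists>h\<in>fun_span I g. \<exists>c. f = (\<lambda>x. h x + c *\<^sub>R g j x))"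
    (is "?L \<longleftrightarrow> ?R")
proof
  assume ?L
  then obtain u where "f = (\<lambda>x. \<Sum>i\<in>insert j I. u i *\<^sub>R g i x)"
    unfolding fun_span_def by blast
  then have "f = (\<lambda>x. (\<Sum>i\<in>I. u i *\<^sub>R g i x) + u j *\<^sub>R g j x)"
    using assms by (simp add: add.commute)
  moreover have "(\<lambda>x. \<Sum>i\<in>I. u i *\<^sub>R g i x) \<in> fun_span I g"
    unfolding fun_span_def by blast
  ultimately show ?R by (intro bexI exI)
next
  assume ?R
  then obtain u c where f: "f = (\<lambda>x. (\<Sum>i\<in>I. u i *\<^sub>R g i x) + c *\<^sub>R g j x)"
    unfolding fun_span_def by blast
  have "(\<Sum>i\<in>I. u i *\<^sub>R g i x) = (\<Sum>i\<in>I. (u(j := c)) i *\<^sub>R g i x)" for x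
    using assms by (intro sum.cong) auto
  then have "f = (\<lambda>x. \<Sum>i\<in>insert j I. (u(j := c)) i *\<^sub>R g i x)"
    using assms by (simp add: f add.commute)
  then show ?L unfolding fun_span_def by blast
qed

lemma fun_span_generator:
  assumes "finite I" "j \<in> I" shows "g j \<in> fun_span I g"
proof -
  have "g j = (\<lambda>x. \<Sum>i\<in>I. (if i = j then 1 else 0) *\<^sub>R g i x)"
    using assms by (simp add: if_distrib[of "\<lambda>c. c *\<^sub>R _"] sum.delta cong: if_cong)
  then show ?thesis unfolding fun_span_def by (intro CollectI exI[of _ "\<lambda>i. if i = j then 1 else 0"]) simp
qed

lemma fun_span_sum:
  assumes "\<And>j. j \<in> J \<Longrightarrow> f j \<in> fun_span I g"
  shows "(\<lambda>x. \<Sum>j\<in>J. c j *\<^sub>R f j x) \<in> fun_span I g"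
  using assms
proof (induction J rule: infinite_finite_induct)
  case (insert j J)
  then have "(\<lambda>x. (\<Sum>j\<in>J. c j *\<^sub>R f j x) + c j *\<^sub>R f j x) \<in> fun_span I g"
    by (intro fun_span_axpy) auto
  then show ?case using insert by (simp add: add.commute)
qed (simp_all add: fun_span_zero)

text \<open>
  Linearity is confined to \<open>V\<close> because an integral is linear on integrable functions only.
\<close>

definition linear_on_fun :: "('a \<Rightarrow> 'b::real_vector) set \<Rightarrow> (('a \<Rightarrow> 'b) \<Rightarrow> real) \<Rightarrow> bool" where
  "linear_on_fun V L \<longleftrightarrow> (\<forall>f\<in>V. \<forall>h\<in>V. \<forall>c. L (\<lambda>x. f x + c *\<^sub>R h x) = L f + c * L h)"

lemma linear_on_funD:
  "linear_on_fun V L \<Longrightarrow> f \<in> V \<Longrightarrow> h \<in> V \<Longrightarrow> L (\<lambda>x. f x + c *\<^sub>R h x) = L f + c * L h"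
  unfolding linear_on_fun_def by blast

text \<open>
  The Riesz representation theorem on the span of finitely many functions, by Gram--Schmidt: a new
  generator is replaced by its component \<open>e\<close> orthogonal to the span of the old ones.  Either \<open>e = 0\<close>
  and the span has not grown, or the old representative has to be corrected by a multiple of \<open>e\<close>.
  The larger space \<open>V\<close> only serves to keep the hypotheses fixed along the induction.
\<close>

lemma riesz_representation:
  assumes "finite I" and "fun_span I g \<subseteq> V"
    and axpy: "\<And>f h c. f \<in> V \<Longrightarrow> h \<in> V \<Longrightarrow> (\<lambda>x. f x + c *\<^sub>R h x) \<in> V"
    and lin: "\<And>f. f \<in> V \<Longrightarrow> linear_on_fun V (B f)"
    and sym: "\<And>f h. B f h = B h f"
    and pos: "\<And>f. f \<in> V \<Longrightarrow> B f f = 0 \<Longrightarrow> f = (\<lambda>x. 0)"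
    and "linear_on_fun V L"
  shows "\<exists>G\<in>fun_span I g. \<forall>\<tau>\<in>fun_span I g. B G \<tau> = L \<tau>"
  using assms(1,2,7)
proof (induction I arbitrary: L rule: finite_induct)
  case empty
  have span: "fun_span {} g = {\<lambda>x. 0}" unfolding fun_span_def by simp
  have "L' (\<lambda>x. 0) = 0" if "linear_on_fun V L'" for L'
    using linear_on_funD[OF that, of "\<lambda>x. 0" "\<lambda>x. 0" 1] empty.prems(1) span by simp
  then show ?case using empty lin by (simp add: span) (metis (no_types))
next
  case (insert j I)
  let ?W = "fun_span I g" and ?W' = "fun_span (insert j I) g"
  note W' = fun_span_insert[OF insert.hyps, of _ g]
  have WW': "?W \<subseteq> ?W'"
  proof
    fix f assume "f \<in> ?W"
    then show "f \<in> ?W'" unfolding W' by (intro bexI[of _ f] exI[of _ 0]) auto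
  qed
  have WV: "?W \<subseteq> V" using WW' insert.prems by blast
  have gj: "g j \<in> V"
  proof -
    have "g j \<in> ?W'" unfolding W' by (intro bexI[of _ "\<lambda>x. 0"] exI[of _ 1]) (auto simp: fun_span_zero)
    then show ?thesis using insert.prems by blast
  qed
  \<comment> \<open>\<open>q\<close> is the projection of the new generator, \<open>G\<close> the representative on the old span.\<close>
  obtain q where q: "q \<in> ?W" "\<forall>\<tau>\<in>?W. B q \<tau> = B (g j) \<tau>"
    using insert.IH[OF WV lin[OF gj]] by blast
  obtain G where G: "G \<in> ?W" "\<forall>\<tau>\<in>?W. B G \<tau> = L \<tau>"
    using insert.IH[OF WV insert.prems(2)] by blast
  define e where "e = (\<lambda>x. g j x + (-1) *\<^sub>R q x)"
  have qV: "q \<in> V" and GV: "G \<in> V" using q G WV by auto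
  have eV: "e \<in> V" unfolding e_def using gj qV axpy by blast
  have e_orth: "B \<tau> e = 0" if "\<tau> \<in> ?W" for \<tau>
  proof -
    have "B \<tau> e = B \<tau> (g j) + (-1) * B \<tau> q"
      unfolding e_def using linear_on_funD[OF lin gj qV] that WV by blast
    then show ?thesis using q(2) that sym by simp
  qed
  have split: "\<exists>h\<in>?W. \<exists>c. \<tau> = (\<lambda>x. h x + c *\<^sub>R e x)" if \<tau>W': "\<tau> \<in> ?W'" for \<tau>
  proof -
    obtain h where h: "h \<in> ?W" and "\<exists>c. \<tau> = (\<lambda>x. h x + c *\<^sub>R g j x)"
      using \<tau>W'[unfolded W'] by (elim bexE)
    then obtain c where \<tau>: "\<tau> = (\<lambda>x. h x + c *\<^sub>R g j x)" by (elim exE)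
    have "\<tau> = (\<lambda>x. (h x + c *\<^sub>R q x) + c *\<^sub>R e x)"
      unfolding \<tau> e_def by (simp add: algebra_simps)
    with fun_span_axpy[OF h q(1), of c] show ?thesis by (intro bexI exI)
  qed
  show ?case
  proof (cases "B e e = 0")
    case True
    then have e0: "e = (\<lambda>x. 0)" using pos eV by blast
    have "?W' \<subseteq> ?W"
    proof
      fix f assume "f \<in> ?W'"
      then show "f \<in> ?W" using split[of f] by (auto simp: e0)
    qed
    then show ?thesis using G WW' by blast
  next
    case False
    \<comment> \<open>The multiple of \<open>e\<close> for which \<open>H\<close> also represents \<open>L\<close> at \<open>e\<close>.\<close>
    define r where "r = (L e - B G e) / B e e"
    define H where "H = (\<lambda>x. G x + r *\<^sub>R e x)"
    have HV: "H \<in> V" unfolding H_def using axpy GV eV by blast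
    have "H = (\<lambda>x. (G x + (-r) *\<^sub>R q x) + r *\<^sub>R g j x)"
      unfolding H_def e_def by (simp add: algebra_simps)
    then have "H \<in> ?W'" unfolding W' using fun_span_axpy[OF G(1) q(1), of "-r"] by (intro bexI exI)
    moreover have "B H \<tau> = L \<tau>" if "\<tau> \<in> ?W'" for \<tau>
    proof -
      have BH: "B H f = B G f + r * B e f" if "f \<in> V" for f
        unfolding H_def using linear_on_funD[OF lin[OF that] GV eV] sym by metis
      obtain h c where h: "h \<in> ?W" "\<tau> = (\<lambda>x. h x + c *\<^sub>R e x)"
        using split[OF \<open>\<tau> \<in> ?W'\<close>] by (elim bexE exE)
      have hV: "h \<in> V" using h WV by blast
      have "B H \<tau> = B H h + c * B H e" unfolding h(2) using linear_on_funD[OF lin[OF HV] hV eV] .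
      also have "B H h = L h" using BH[OF hV] G(2) h(1) e_orth[OF h(1)] sym[of e h] by simp
      also have "B H e = L e" using BH[OF eV] False by (simp add: r_def)
      finally show ?thesis unfolding h(2) using linear_on_funD[OF insert.prems(2) hV eV] by simp
    qed
    ultimately show ?thesis by blast
  qed
qed

section \<open>Polynomials in the plane\<close>

definition exponents :: "int \<Rightarrow> (nat \<times> nat) set" where
  "exponents m = {(i, j). int (i + j) \<le> m}"

definition monomial :: "nat \<times> nat \<Rightarrow> point \<Rightarrow> real" where
  "monomial e x = (x $ 1) ^ fst e * (x $ 2) ^ snd e"

lemma finite_exponents: "finite (exponents m)"
proof (rule finite_subset)
  show "exponents m \<subseteq> {..nat m} \<times> {..nat m}" unfolding exponents_def by auto
qed simp

lemma polynomials_eq_span: "polynomials m = fun_span (exponents m) monomial"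
proof -
  have eq: "(\<Sum>(i, j) | int (i + j) \<le> m. c i j * (x $ 1) ^ i * (x $ 2) ^ j)
      = (\<Sum>e\<in>exponents m. c (fst e) (snd e) *\<^sub>R monomial e x)" for c and x :: point
    unfolding exponents_def monomial_def by (intro sum.cong) (auto simp: mult.assoc)
  show ?thesis
  proof (intro set_eqI iffI)
    fix p assume "p \<in> polynomials m"
    then obtain c where "\<And>x. p x = (\<Sum>e\<in>exponents m. c (fst e) (snd e) *\<^sub>R monomial e x)"
      unfolding polynomials_def eq by blast
    then show "p \<in> fun_span (exponents m) monomial" unfolding fun_span_def
      by (intro CollectI exI[of _ "\<lambda>e. c (fst e) (snd e)"]) auto
  next
    fix p assume "p \<in> fun_span (exponents m) monomial"
    then obtain c where "p = (\<lambda>x. \<Sum>e\<in>exponents m. c e *\<^sub>R monomial e x)"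
      unfolding fun_span_def by blast
    then show "p \<in> polynomials m" unfolding polynomials_def eq
      by (intro CollectI exI[of _ "\<lambda>i j. c (i, j)"]) simp
  qed
qed

lemma polynomials_axpy:
  "p \<in> polynomials m \<Longrightarrow> q \<in> polynomials m \<Longrightarrow> (\<lambda>x. p x + c * q x) \<in> polynomials m"
  unfolding polynomials_eq_span using fun_span_axpy[of p _ _ q c] by simp

lemma polynomials_zero: "(\<lambda>x. 0) \<in> polynomials m"
  unfolding polynomials_eq_span by (rule fun_span_zero)

lemma polynomials_cmul: "p \<in> polynomials m \<Longrightarrow> (\<lambda>x. c * p x) \<in> polynomials m"
  using polynomials_axpy[OF polynomials_zero] by simp

lemma polynomials_sum:
  "(\<And>j. j \<in> J \<Longrightarrow> f j \<in> polynomials m) \<Longrightarrow> (\<lambda>x. \<Sum>j\<in>J. c j * f j x) \<in> polynomials m"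
  unfolding polynomials_eq_span using fun_span_sum[of J f "exponents m" monomial c] by simp

lemma monomial_in_polynomials: "int (i + j) \<le> m \<Longrightarrow> monomial (i, j) \<in> polynomials m"
  unfolding polynomials_eq_span by (intro fun_span_generator finite_exponents) (simp add: exponents_def)

lemma polynomialsE:
  assumes "p \<in> polynomials m"
  obtains c where "p = (\<lambda>x. \<Sum>e\<in>exponents m. c e * monomial e x)"
  using assms unfolding polynomials_eq_span fun_span_def by auto

lemma polynomials_mono: "p \<in> polynomials m \<Longrightarrow> m \<le> n \<Longrightarrow> p \<in> polynomials n"
proof (elim polynomialsE)
  fix c assume "m \<le> n" and p: "p = (\<lambda>x. \<Sum>e\<in>exponents m. c e * monomial e x)"
  show ?thesis unfolding p
  proof (rule polynomials_sum)
    fix e assume "e \<in> exponents m"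
    then show "monomial e \<in> polynomials n" using \<open>m \<le> n\<close>
      by (cases e) (auto simp: exponents_def intro!: monomial_in_polynomials)
  qed
qed

lemma polynomials_mult:
  assumes "p \<in> polynomials m" "q \<in> polynomials n"
  shows "(\<lambda>x. p x * q x) \<in> polynomials (m + n)"
proof -
  obtain c where p: "p = (\<lambda>x. \<Sum>e\<in>exponents m. c e * monomial e x)"
    using assms(1) by (rule polynomialsE)
  obtain d where q: "q = (\<lambda>x. \<Sum>e\<in>exponents n. d e * monomial e x)"
    using assms(2) by (rule polynomialsE)
  have "(\<lambda>x. p x * q x) = (\<lambda>x. \<Sum>(e, e')\<in>exponents m \<times> exponents n.
      (c e * d e') * (monomial e x * monomial e' x))"
    unfolding p q by (simp add: sum_product sum.cartesian_product mult_ac)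
  also have "\<dots> = (\<lambda>x. \<Sum>u\<in>exponents m \<times> exponents n.
      (c (fst u) * d (snd u)) * monomial (fst (fst u) + fst (snd u), snd (fst u) + snd (snd u)) x)"
    by (intro ext sum.cong) (auto simp: monomial_def power_add)
  also have "\<dots> \<in> polynomials (m + n)"
    by (intro polynomials_sum monomial_in_polynomials) (auto simp: exponents_def)
  finally show ?thesis .
qed

lemma polynomials_const: "0 \<le> m \<Longrightarrow> (\<lambda>x. c) \<in> polynomials m"
  using polynomials_cmul[OF monomial_in_polynomials[of 0 0 m], of c] by (simp add: monomial_def)

lemma polynomials_power: "p \<in> polynomials 1 \<Longrightarrow> (\<lambda>x. p x ^ i) \<in> polynomials (int i)"
proof (induction i)
  case 0
  then show ?case using polynomials_const[of 0 1] by simp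
next
  case (Suc i)
  then show ?case using polynomials_mult[of p 1 "\<lambda>x. p x ^ i" "int i"] by simp
qed

lemma polynomials_continuous: "p \<in> polynomials m \<Longrightarrow> continuous_on S p"
  by (elim polynomialsE) (auto simp: monomial_def intro!: continuous_intros)

text \<open>
  The continuous partial derivatives make the divergence of a polynomial field integrable over a
  bounded element, so that integrals against it depend linearly on the field.
\<close>

lemma polynomials_derivative:
  assumes "p \<in> polynomials m"
  shows "\<exists>p1 p2. continuous_on UNIV p1 \<and> continuous_on UNIV p2 \<and>
    (\<forall>x. (p has_derivative (\<lambda>h. p1 x * h $ 1 + p2 x * h $ 2)) (at x))"
proof -
  obtain c where p: "p = (\<lambda>x. \<Sum>e\<in>exponents m. c e * monomial e x)"
    using assms by (rule polynomialsE)
  define d1 where "d1 x = (\<Sum>e\<in>exponents m. c e * (real (fst e) * (x $ 1) ^ (fst e - 1) * (x $ 2) ^ snd e))"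
    for x :: point
  define d2 where "d2 x = (\<Sum>e\<in>exponents m. c e * (real (snd e) * (x $ 2) ^ (snd e - 1) * (x $ 1) ^ fst e))"
    for x :: point
  have "(p has_derivative (\<lambda>h. d1 x * h $ 1 + d2 x * h $ 2)) (at x)" for x
  proof -
    have coord: "((\<lambda>x. x $ i) has_derivative (\<lambda>h. h $ i)) (at x)" for i :: 2
      by (intro bounded_linear_imp_has_derivative bounded_linear_vec_nth)
    have "(monomial e has_derivative
        (\<lambda>h. real (fst e) * (x $ 1) ^ (fst e - 1) * (x $ 2) ^ snd e * h $ 1
          + real (snd e) * (x $ 2) ^ (snd e - 1) * (x $ 1) ^ fst e * h $ 2)) (at x)" for e
      unfolding monomial_def
      by (rule has_derivative_eq_rhs[OF has_derivative_mult[OF has_derivative_power[OF coord]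
              has_derivative_power[OF coord]]]) (simp add: algebra_simps)
    then have "(p has_derivative (\<lambda>h. \<Sum>e\<in>exponents m. c e *
        (real (fst e) * (x $ 1) ^ (fst e - 1) * (x $ 2) ^ snd e * h $ 1
          + real (snd e) * (x $ 2) ^ (snd e - 1) * (x $ 1) ^ fst e * h $ 2))) (at x)"
      unfolding p by (intro has_derivative_sum has_derivative_mult_right)
    then show ?thesis
      by (rule has_derivative_eq_rhs)
         (simp add: d1_def d2_def sum_distrib_right sum_distrib_left sum.distrib[symmetric] algebra_simps)
  qed
  moreover have "continuous_on UNIV d1" "continuous_on UNIV d2"
    unfolding d1_def d2_def by (auto intro!: continuous_intros)
  ultimately show ?thesis by blast
qed

lemma polys_onE:
  assumes "f \<in> polys_on m X"
  obtains p where "p \<in> polynomials m" "f = (\<lambda>x. if x \<in> closure X then p x else 0)"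
  using assms unfolding polys_on_def by (rule imageE)

lemma polys_onI: "p \<in> polynomials m \<Longrightarrow> (\<lambda>x. if x \<in> closure X then p x else 0) \<in> polys_on m X"
  unfolding polys_on_def by (rule imageI)

lemma polys_on_outside: "f \<in> polys_on m X \<Longrightarrow> x \<notin> closure X \<Longrightarrow> f x = 0"
  unfolding polys_on_def by auto

lemma polys_on_eqI:
  assumes "f \<in> polys_on m X" "g \<in> polys_on n X" "\<And>x. x \<in> closure X \<Longrightarrow> f x = g x"
  shows "f = g"
proof (rule ext)
  fix x show "f x = g x"
    using polys_on_outside[OF assms(1), of x] polys_on_outside[OF assms(2), of x] assms(3)[of x]
    by (cases "x \<in> closure X") auto
qed

lemma polys_on_axpy:
  assumes "f \<in> polys_on m X" "g \<in> polys_on m X"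
  shows "(\<lambda>x. f x + c * g x) \<in> polys_on m X"
proof -
  obtain p where p: "p \<in> polynomials m" "f = (\<lambda>x. if x \<in> closure X then p x else 0)"
    using assms(1) by (rule polys_onE)
  obtain q where q: "q \<in> polynomials m" "g = (\<lambda>x. if x \<in> closure X then q x else 0)"
    using assms(2) by (rule polys_onE)
  have "(\<lambda>x. f x + c * g x) = (\<lambda>x. if x \<in> closure X then p x + c * q x else 0)"
    unfolding p q by auto
  then show ?thesis using polys_onI[OF polynomials_axpy[OF p(1) q(1)]] by simp
qed

lemma polys_on_diff:
  "f \<in> polys_on m X \<Longrightarrow> g \<in> polys_on m X \<Longrightarrow> (\<lambda>x. f x - g x) \<in> polys_on m X"
  using polys_on_axpy[of f m X g "-1"] by simp

lemma polys_on_continuous: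
  assumes "f \<in> polys_on m X" "S \<subseteq> closure X" shows "continuous_on S f"
proof -
  obtain p where p: "p \<in> polynomials m" "f = (\<lambda>x. if x \<in> closure X then p x else 0)"
    using assms(1) by (rule polys_onE)
  then show ?thesis using polynomials_continuous[OF p(1), of S] assms(2)
    by (subst continuous_on_cong[OF refl, of _ _ p]) auto
qed

lemma polys_on_eq_span:
  "polys_on m X = fun_span (exponents m) (\<lambda>e x. if x \<in> closure X then monomial e x else 0)"
proof -
  have *: "(\<lambda>x. \<Sum>e\<in>exponents m. c e *\<^sub>R (if x \<in> closure X then monomial e x else 0))
      = (\<lambda>x. if x \<in> closure X then (\<Sum>e\<in>exponents m. c e *\<^sub>R monomial e x) else 0)" for c
    by (auto intro!: ext)
  have "fun_span (exponents m) (\<lambda>e x. if x \<in> closure X then monomial e x else 0)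
      = range (\<lambda>c x. if x \<in> closure X then (\<Sum>e\<in>exponents m. c e *\<^sub>R monomial e x) else 0)"
    unfolding fun_span_def * by (simp add: full_SetCompr_eq)
  also have "\<dots> = polys_on m X"
    unfolding polys_on_def polynomials_eq_span fun_span_def by (simp add: full_SetCompr_eq image_image cong: if_cong)
  finally show ?thesis ..
qed

section \<open>Integrals over elements and edges\<close>

lemma set_integrable_continuous:
  fixes f :: "'a::euclidean_space \<Rightarrow> real"
  assumes "compact K" "continuous_on K f" "S \<subseteq> K" "S \<in> sets lborel"
  shows "set_integrable lborel S f"
proof -
  have "set_integrable lborel K f"
    unfolding set_integrable_def by (rule borel_integrable_compact[OF assms(1,2)])
  then show ?thesis by (rule set_integrable_subset) (use assms in auto)
qed

text \<open>
  A nonnegative continuous function with zero integral vanishes almost everywhere; the set where it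
  is nonzero is open in \<open>U\<close>, and a null open set is empty.  Continuity extends this to \<open>closure U\<close>.
\<close>

lemma set_integral_0_imp_0:
  fixes f :: "'a::euclidean_space \<Rightarrow> real"
  assumes "compact K" "continuous_on K f" "S \<subseteq> K" "S \<in> sets lborel"
    and nonneg: "\<And>x. x \<in> S \<Longrightarrow> 0 \<le> f x" and zero: "(LINT x:S|lborel. f x) = 0"
    and "open U" "U \<subseteq> S" and x: "x \<in> closure U"
  shows "f x = 0"
proof -
  have int: "integrable lborel (\<lambda>x. indicator S x *\<^sub>R f x)"
    using set_integrable_continuous[OF assms(1-4)] unfolding set_integrable_def .
  have "AE x in lborel. indicator S x *\<^sub>R f x = 0"
    using zero nonneg integral_nonneg_eq_0_iff_AE[OF int]
    unfolding set_lebesgue_integral_def by (auto simp: indicator_def)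
  then have ae: "AE x in lborel. x \<notin> {x \<in> U. f x \<noteq> 0}"
    by (rule eventually_mono) (use assms(8) in \<open>auto simp: indicator_def split: if_splits\<close>)
  have fU: "continuous_on U f" using assms by (meson continuous_on_subset subset_trans)
  have op: "open {x \<in> U. f x \<noteq> 0}"
    using continuous_open_preimage[OF fU \<open>open U\<close>, of "- {0}"] by (simp add: vimage_def Int_def open_Compl)
  then have "emeasure lborel {x \<in> U. f x \<noteq> 0} = 0"
    using ae by (subst (asm) AE_iff_measurable[OF _ refl]) auto
  then have "negligible {x \<in> U. f x \<noteq> 0}"
    using op by (simp add: negligible_iff_null_sets null_sets_def null_sets_completionI)
  then have "{x \<in> U. f x \<noteq> 0} = {}" using op open_not_negligible by blast
  then have "f y = 0" if "y \<in> U" for y using that by blast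
  moreover have "closure U \<subseteq> K" using assms by (meson closure_minimal compact_imp_closed subset_trans)
  ultimately show ?thesis
    using continuous_constant_on_closure[of U f 0 x] assms(2) x continuous_on_subset by blast
qed

lemma edge_integral_cmul: "edge_integral E (\<lambda>x. c * f x) = c * edge_integral E f"
  unfolding edge_integral_def by (simp split: prod.splits)

lemma element_integral_cmul: "element_integral T (\<lambda>x. c * f x) = c * element_integral T f"
  unfolding element_integral_def by simp

lemma element_integral_nonneg:
  "(\<And>x. x \<in> T \<Longrightarrow> 0 \<le> f x) \<Longrightarrow> 0 \<le> element_integral T f"
  unfolding element_integral_def set_lebesgue_integral_def
  by (intro integral_nonneg_AE) (auto simp: indicator_def)

text \<open>
  An edge together with the ends that its definition selects: line integrals, the parametrisation
  \<open>par\<close> and its affine inverse \<open>coord\<close> all refer to this choice.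
\<close>

locale edge =
  fixes E :: "point set" and a b :: point
  assumes ends: "edge_ends E = (a, b)" and neq: "a \<noteq> b" and seg: "E = open_segment a b"
begin

lemma closure_eq: "closure E = closed_segment a b"
  using neq seg by simp

lemma endpoints_eq: "endpoints E = {a, b}"
  unfolding endpoints_def ends by simp

definition par :: "real \<Rightarrow> point" where "par t = a + t *\<^sub>R (b - a)"

definition coord :: "point \<Rightarrow> real" where "coord x = ((x - a) \<bullet> (b - a)) / ((b - a) \<bullet> (b - a))"

lemma coord_par: "coord (par t) = t"
  using neq by (simp add: coord_def par_def)

lemma par_eq: "par t = (1 - t) *\<^sub>R a + t *\<^sub>R b"
  by (simp add: par_def algebra_simps)

lemma par_in: "t \<in> {0..1} \<Longrightarrow> par t \<in> closure E"
  unfolding closure_eq par_eq in_segment by auto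

lemma closureE: assumes "x \<in> closure E" obtains t where "t \<in> {0..1}" "x = par t"
  using assms unfolding closure_eq in_segment par_eq by auto

lemma par_in_open: "0 < t \<Longrightarrow> t < 1 \<Longrightarrow> par t \<in> E"
  unfolding seg par_eq in_segment using neq by auto

lemma integral_eq: "edge_integral E f = dist a b * (LINT t:{0..1}|lborel. f (par t))"
  unfolding edge_integral_def ends par_def by simp

lemma par_continuous: "continuous_on {0..1} par"
  unfolding par_def by (intro continuous_intros)

lemma continuous_par: "continuous_on (closure E) f \<Longrightarrow> continuous_on {0..1} (\<lambda>t. f (par t))"
  by (rule continuous_on_compose2[OF _ par_continuous]) (use par_in in auto)

lemma integrable_par:
  fixes f :: "point \<Rightarrow> real"
  shows "continuous_on (closure E) f \<Longrightarrow> set_integrable lborel {0..1} (\<lambda>t. f (par t))"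
  by (rule set_integrable_continuous[OF compact_Icc continuous_par]) auto

lemma integral_axpy:
  assumes "continuous_on (closure E) f" "continuous_on (closure E) g"
  shows "edge_integral E (\<lambda>x. f x + c * g x) = edge_integral E f + c * edge_integral E g"
proof -
  have "set_integrable lborel {0..1} (\<lambda>t. c * g (par t))"
    using assms(2) by (intro integrable_par continuous_intros)
  then show ?thesis unfolding integral_eq
    using set_integral_add(2)[OF integrable_par[OF assms(1)], of "\<lambda>t. c * g (par t)"]
    by (simp add: algebra_simps)
qed

lemma integral_cong:
  assumes "\<And>x. x \<in> closure E \<Longrightarrow> f x = g x" shows "edge_integral E f = edge_integral E g"
proof -
  have "(LINT t:{0..1}|lborel. f (par t)) = (LINT t:{0..1}|lborel. g (par t))"
    by (rule set_lebesgue_integral_cong) (use assms par_in in auto)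
  then show ?thesis unfolding integral_eq by simp
qed

lemma integral_nonneg:
  assumes "\<And>x. x \<in> closure E \<Longrightarrow> 0 \<le> f x" shows "0 \<le> edge_integral E f"
  unfolding integral_eq set_lebesgue_integral_def
  by (intro mult_nonneg_nonneg integral_nonneg_AE) (use assms par_in in \<open>auto simp: indicator_def\<close>)

lemma integral_0_imp_0:
  assumes "continuous_on (closure E) f" "\<And>x. x \<in> closure E \<Longrightarrow> 0 \<le> f x" "edge_integral E f = 0"
    and x: "x \<in> closure E"
  shows "f x = 0"
proof -
  have z: "(LINT t:{0..1}|lborel. f (par t)) = 0" using assms(3) neq unfolding integral_eq by simp
  obtain t where t: "t \<in> {0..1}" "x = par t" using x by (rule closureE)
  have "f (par t) = 0"
    by (rule set_integral_0_imp_0[OF compact_Icc continuous_par[OF assms(1)] subset_refl _ _ z, of "{0<..<1}"])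
       (use assms(2) par_in t(1) in auto)
  then show ?thesis using t by simp
qed

lemma integral_Cauchy_Schwarz:
  assumes f: "continuous_on (closure E) f" and g: "continuous_on (closure E) g"
  shows "(edge_integral E (\<lambda>x. f x * g x))\<^sup>2 \<le> edge_integral E (\<lambda>x. (f x)\<^sup>2) * edge_integral E (\<lambda>x. (g x)\<^sup>2)"
proof -
  let ?A = "edge_integral E (\<lambda>x. (f x)\<^sup>2)" and ?B = "edge_integral E (\<lambda>x. (g x)\<^sup>2)"
    and ?X = "edge_integral E (\<lambda>x. f x * g x)"
  have quad: "0 \<le> ?A + 2 * l * ?X + l\<^sup>2 * ?B" for l
  proof -
    have "0 \<le> edge_integral E (\<lambda>x. (f x + l * g x)\<^sup>2)" by (intro integral_nonneg) simp
    also have "\<dots> = edge_integral E (\<lambda>x. ((f x)\<^sup>2 + (2 * l) * (f x * g x)) + l\<^sup>2 * (g x)\<^sup>2)"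
      by (intro integral_cong) (simp add: power2_eq_square algebra_simps)
    also have "\<dots> = edge_integral E (\<lambda>x. (f x)\<^sup>2 + (2 * l) * (f x * g x)) + l\<^sup>2 * ?B"
      using f g by (intro integral_axpy continuous_intros)
    also have "edge_integral E (\<lambda>x. (f x)\<^sup>2 + (2 * l) * (f x * g x)) = ?A + (2 * l) * ?X"
      using f g by (intro integral_axpy continuous_intros)
    finally show ?thesis by simp
  qed
  have B: "0 \<le> ?B" by (intro integral_nonneg) simp
  show ?thesis
  proof (cases "?B = 0")
    case True
    then have "g x = 0" if "x \<in> closure E" for x
      using integral_0_imp_0[of "\<lambda>x. (g x)\<^sup>2"] g that by (auto intro!: continuous_intros)
    then have "?X = edge_integral E (\<lambda>x. 0 * f x)" by (intro integral_cong) auto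
    also have "\<dots> = 0 * edge_integral E f" by (rule edge_integral_cmul)
    finally show ?thesis using True by simp
  next
    case False
    then have "0 < ?B" using B by simp
    \<comment> \<open>The minimiser of the quadratic.\<close>
    have "0 \<le> ?A + 2 * (- ?X / ?B) * ?X + (- ?X / ?B)\<^sup>2 * ?B" by (rule quad)
    also have "\<dots> = ?A - ?X\<^sup>2 / ?B" using False by (simp add: power2_eq_square field_simps)
    finally show ?thesis using \<open>0 < ?B\<close> by (simp add: field_simps)
  qed
qed

text \<open>
  The weight is what makes this useful: \<open>w = 1\<close> gives the \<open>L\<^sup>2\<close> projector, and a bubble vanishing
  at both ends of the edge gives the reconstruction \<open>edge_rec\<close>.
\<close>

lemma poly_L2_representation:
  assumes w: "continuous_on (closure E) w" "\<And>x. x \<in> closure E \<Longrightarrow> 0 \<le> w x" "\<And>x. x \<in> E \<Longrightarrow> 0 < w x"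
    and f: "continuous_on (closure E) f"
  shows "\<exists>p\<in>polys_on m E. \<forall>q\<in>polys_on m E.
    edge_integral E (\<lambda>x. w x * (p x * q x)) = edge_integral E (\<lambda>x. f x * q x)"
proof -
  let ?V = "polys_on m E"
  note cont = polys_on_continuous[OF _ subset_refl]
  show ?thesis unfolding polys_on_eq_span
  proof (rule riesz_representation[where V = ?V and B = "\<lambda>p q. edge_integral E (\<lambda>x. w x * (p x * q x))"
        and L = "\<lambda>q. edge_integral E (\<lambda>x. f x * q x)"])
    show "finite (exponents m)" by (rule finite_exponents)
    show "fun_span (exponents m) (\<lambda>e x. if x \<in> closure E then monomial e x else 0) \<subseteq> ?V"
      by (simp add: polys_on_eq_span)
    show "(\<lambda>x. p x + c *\<^sub>R q x) \<in> ?V" if "p \<in> ?V" "q \<in> ?V" for p q c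
      using polys_on_axpy[OF that] by simp
    show "linear_on_fun ?V (\<lambda>q. edge_integral E (\<lambda>x. w x * (p x * q x)))" if "p \<in> ?V" for p
      unfolding linear_on_fun_def
    proof (intro ballI allI)
      fix q r c assume "q \<in> ?V" "r \<in> ?V"
      then have "edge_integral E (\<lambda>x. w x * (p x * q x) + c * (w x * (p x * r x)))
        = edge_integral E (\<lambda>x. w x * (p x * q x)) + c * edge_integral E (\<lambda>x. w x * (p x * r x))"
        using that by (intro integral_axpy continuous_intros) (auto intro: cont w(1))
      then show "edge_integral E (\<lambda>x. w x * (p x * (q x + c *\<^sub>R r x)))
        = edge_integral E (\<lambda>x. w x * (p x * q x)) + c * edge_integral E (\<lambda>x. w x * (p x * r x))"
        by (simp add: algebra_simps)
    qed
    show "edge_integral E (\<lambda>x. w x * (p x * q x)) = edge_integral E (\<lambda>x. w x * (q x * p x))" for p q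
      by (simp add: mult.commute)
    show "p = (\<lambda>x. 0)" if p: "p \<in> ?V" and 0: "edge_integral E (\<lambda>x. w x * (p x * p x)) = 0" for p
    proof -
      have "w x * (p x * p x) = 0" if "x \<in> closure E" for x
        by (intro integral_0_imp_0[OF _ _ 0 that] continuous_intros) (auto intro: cont[OF p] w(1) simp: w(2))
      then have "p x = 0" if "x \<in> E" for x using w(3)[OF that] that closure_subset by fastforce
      then have "p x = 0" if "x \<in> closure E" for x
        using continuous_constant_on_closure[of E p 0 x] cont[OF p] that by blast
      then show ?thesis using polys_on_outside[OF p] by fastforce
    qed
    show "linear_on_fun ?V (\<lambda>q. edge_integral E (\<lambda>x. f x * q x))"
      unfolding linear_on_fun_def
    proof (intro ballI allI)
      fix q r c assume "q \<in> ?V" "r \<in> ?V"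
      then have "edge_integral E (\<lambda>x. f x * q x + c * (f x * r x))
        = edge_integral E (\<lambda>x. f x * q x) + c * edge_integral E (\<lambda>x. f x * r x)"
        by (intro integral_axpy continuous_intros) (auto intro: cont f)
      then show "edge_integral E (\<lambda>x. f x * (q x + c *\<^sub>R r x))
        = edge_integral E (\<lambda>x. f x * q x) + c * edge_integral E (\<lambda>x. f x * r x)"
        by (simp add: algebra_simps)
    qed
  qed
qed

lemma orthogonal_imp_0:
  assumes "p \<in> polys_on m E" "\<forall>q\<in>polys_on m E. edge_integral E (\<lambda>x. p x * q x) = 0"
    "x \<in> closure E"
  shows "p x = 0"
proof -
  have "edge_integral E (\<lambda>x. p x * p x) = 0" using assms by blast
  then have "p x * p x = 0"
    using assms(1,3) polys_on_continuous[OF assms(1) subset_refl]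
    by (intro integral_0_imp_0[of "\<lambda>x. p x * p x"] continuous_intros) auto
  then show ?thesis by simp
qed

text \<open>
  This turns the definite description in \<open>edge_projection\<close> into the orthogonality relation.
\<close>

lemma edge_projection_eq_iff:
  assumes f: "continuous_on (closure E) f" and p: "p \<in> polys_on m E"
  shows "edge_projection m E f = p \<longleftrightarrow> (\<forall>q\<in>polys_on m E. edge_integral E (\<lambda>x. (f x - p x) * q x) = 0)"
proof -
  let ?P = "\<lambda>p. p \<in> polys_on m E \<and> (\<forall>q\<in>polys_on m E. edge_integral E (\<lambda>x. (f x - p x) * q x) = 0)"
  note cont = polys_on_continuous[OF _ subset_refl]
  have split: "edge_integral E (\<lambda>x. (f x - p x) * q x)
      = edge_integral E (\<lambda>x. f x * q x) - edge_integral E (\<lambda>x. p x * q x)"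
    if "p \<in> polys_on m E" "q \<in> polys_on m E" for p q
  proof -
    have "edge_integral E (\<lambda>x. (f x - p x) * q x) = edge_integral E (\<lambda>x. f x * q x + (-1) * (p x * q x))"
      by (intro integral_cong) (simp add: algebra_simps)
    also have "\<dots> = edge_integral E (\<lambda>x. f x * q x) + (-1) * edge_integral E (\<lambda>x. p x * q x)"
      using that by (intro integral_axpy continuous_intros) (auto intro: cont f)
    finally show ?thesis by simp
  qed
  obtain p0 where p0: "p0 \<in> polys_on m E"
    "\<forall>q\<in>polys_on m E. edge_integral E (\<lambda>x. 1 * (p0 x * q x)) = edge_integral E (\<lambda>x. f x * q x)"
    using poly_L2_representation[OF continuous_on_const, of 1 f m] f by auto
  have P0: "?P p0" using p0 split by simp
  have uniq: "p1 = p0" if "?P p1" for p1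
  proof (rule polys_on_eqI)
    show "p1 \<in> polys_on m E" "p0 \<in> polys_on m E" using that p0(1) by auto
    fix x assume "x \<in> closure E"
    have "edge_integral E (\<lambda>x. (p1 x - p0 x) * q x) = 0" if q: "q \<in> polys_on m E" for q
    proof -
      have "edge_integral E (\<lambda>x. (p1 x - p0 x) * q x) = edge_integral E (\<lambda>x. p1 x * q x + (-1) * (p0 x * q x))"
        by (intro integral_cong) (simp add: algebra_simps)
      also have "\<dots> = edge_integral E (\<lambda>x. p1 x * q x) + (-1) * edge_integral E (\<lambda>x. p0 x * q x)"
        using \<open>?P p1\<close> p0(1) q by (intro integral_axpy continuous_intros) (auto intro: cont)
      also have "\<dots> = 0"
        using split[OF p0(1) q] split[of p1 q] P0 \<open>?P p1\<close> q by simp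
      finally show ?thesis .
    qed
    then have "p1 x - p0 x = 0"
      using orthogonal_imp_0[of "\<lambda>x. p1 x - p0 x" m x] polys_on_diff \<open>?P p1\<close> p0(1) \<open>x \<in> closure E\<close>
      by blast
    then show "p1 x = p0 x" by simp
  qed
  have "edge_projection m E f = p0"
    unfolding edge_projection_def by (rule the_equality[of ?P, OF P0 uniq])
  then show ?thesis using P0 uniq p by blast
qed

end

section \<open>Reconstruction on edges\<close>

context edge begin

lemma par_ends: "par 0 = a" "par 1 = b"
  by (simp_all add: par_def)

lemma ends_in_closure: "a \<in> closure E" "b \<in> closure E"
  unfolding closure_eq by simp_all

lemma coord_ends: "coord a = 0" "coord b = 1"
  using coord_par[of 0] coord_par[of 1] unfolding par_ends by auto

lemma coord_bounds: "x \<in> closure E \<Longrightarrow> 0 \<le> coord x \<and> coord x \<le> 1"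
  using coord_par by (elim closureE) auto

lemma coord_bounds_open: "x \<in> E \<Longrightarrow> 0 < coord x \<and> coord x < 1"
proof -
  assume "x \<in> E"
  then obtain t where "0 < t" "t < 1" "x = par t" unfolding seg in_segment par_eq by blast
  then show ?thesis using coord_par by auto
qed

lemma par_coord: "x \<in> closure E \<Longrightarrow> par (coord x) = x"
  using coord_par by (elim closureE) auto

lemma coord_polynomial: "coord \<in> polynomials 1"
proof -
  let ?D = "(b - a) \<bullet> (b - a)"
  have mono: "monomial (1, 0) \<in> polynomials 1" "monomial (0, 1) \<in> polynomials 1"
    by (intro monomial_in_polynomials; simp)+
  have "coord = (\<lambda>x. (- (a \<bullet> (b - a)) / ?D + ((b - a) $ 1 / ?D) * monomial (1, 0) x)
      + ((b - a) $ 2 / ?D) * monomial (0, 1) x)"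
    unfolding coord_def monomial_def
    by (intro ext) (simp add: inner_diff_left inner_vec_def sum_2 diff_divide_distrib add_divide_distrib algebra_simps)
  also have "\<dots> \<in> polynomials 1"
    by (intro polynomials_axpy mono polynomials_const) simp
  finally show ?thesis .
qed

text \<open>
  Polynomials on an edge are univariate polynomials in its affine parameter.  The degree bound is
  expressed by vanishing coefficients, which also covers \<open>m = -1\<close>, where only \<open>0\<close> is left.
\<close>

lemma polys_on_univariate:
  assumes "f \<in> polys_on m E"
  shows "\<exists>P. (\<forall>i. m < int i \<longrightarrow> coeff P i = 0) \<and> (\<forall>t\<in>{0..1}. f (par t) = poly P t)"
proof -
  obtain p where p: "p \<in> polynomials m" "f = (\<lambda>x. if x \<in> closure E then p x else 0)"
    using assms by (rule polys_onE)
  obtain c where c: "p = (\<lambda>x. \<Sum>e\<in>exponents m. c e * monomial e x)"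
    using p(1) by (rule polynomialsE)
  define P where "P = (\<Sum>e\<in>exponents m. smult (c e)
      ([:a $ 1, (b - a) $ 1:] ^ fst e * [:a $ 2, (b - a) $ 2:] ^ snd e))"
  have "coeff P i = 0" if "m < int i" for i
  proof -
    have "coeff ([:a $ 1, (b - a) $ 1:] ^ fst e * [:a $ 2, (b - a) $ 2:] ^ snd e) i = 0"
      if e: "e \<in> exponents m" for e
    proof (rule coeff_eq_0)
      have d: "degree ([:u, w:] ^ n) \<le> n" for u w :: real and n
        using degree_power_le[of "[:u, w:]" n] by (cases "w = 0") auto
      have "degree ([:a $ 1, (b - a) $ 1:] ^ fst e * [:a $ 2, (b - a) $ 2:] ^ snd e) \<le> fst e + snd e"
        by (rule order_trans[OF degree_mult_le add_mono[OF d d]])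
      also have "\<dots> < i" using e \<open>m < int i\<close> by (auto simp: exponents_def)
      finally show "degree ([:a $ 1, (b - a) $ 1:] ^ fst e * [:a $ 2, (b - a) $ 2:] ^ snd e) < i" .
    qed
    then show ?thesis unfolding P_def coeff_sum by (intro sum.neutral) auto
  qed
  moreover have "f (par t) = poly P t" if "t \<in> {0..1}" for t
  proof -
    have "f (par t) = p (par t)" using p(2) par_in[OF that] by simp
    also have "\<dots> = poly P t" unfolding c P_def poly_sum
      by (intro sum.cong refl) (simp add: monomial_def par_def algebra_simps)
    finally show ?thesis .
  qed
  ultimately show ?thesis by blast
qed

lemma univariate_polys_on:
  assumes "\<And>i. m < int i \<Longrightarrow> coeff P i = 0"
  shows "(\<lambda>x. if x \<in> closure E then poly P (coord x) else 0) \<in> polys_on m E"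
proof (rule polys_onI)
  let ?I = "{i \<in> {..degree P}. int i \<le> m}"
  have "(\<lambda>x. poly P (coord x)) = (\<lambda>x. \<Sum>i\<in>?I. coeff P i * coord x ^ i)"
  proof
    fix x
    have "poly P (coord x) = (\<Sum>i\<le>degree P. coeff P i * coord x ^ i)" by (rule poly_altdef)
    also have "\<dots> = (\<Sum>i\<in>?I. coeff P i * coord x ^ i)"
      by (rule sum.mono_neutral_right) (use assms in \<open>auto simp: not_le\<close>)
    finally show "poly P (coord x) = (\<Sum>i\<in>?I. coeff P i * coord x ^ i)" .
  qed
  also have "\<dots> \<in> polynomials m"
  proof (rule polynomials_sum)
    fix i assume "i \<in> ?I"
    then show "(\<lambda>x. coord x ^ i) \<in> polynomials m"
      using polynomials_mono[OF polynomials_power[OF coord_polynomial, of i]] by simp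
  qed
  finally show "(\<lambda>x. poly P (coord x)) \<in> polynomials m" .
qed

text \<open>
  The end values and the moments against degree \<open>k - 1\<close> determine a polynomial of degree \<open>k + 1\<close>.
  Vanishing at both ends gives \<open>d = t (1 - t) r\<close> with \<open>r\<close> of degree \<open>k - 1\<close>, where \<open>t\<close> is the
  parameter; orthogonality to \<open>r\<close> itself then says that the integral of \<open>t (1 - t) r\<^sup>2\<close> is zero.
\<close>

lemma edge_unisolvence:
  assumes d: "d \<in> polys_on (int k + 1) E" "d a = 0" "d b = 0"
    and orth: "\<And>q. q \<in> polys_on (int k - 1) E \<Longrightarrow> edge_integral E (\<lambda>x. d x * q x) = 0"
    and x: "x \<in> closure E"
  shows "d x = 0"
proof -
  obtain P where P: "\<forall>i. int k + 1 < int i \<longrightarrow> coeff P i = 0" "\<forall>t\<in>{0..1}. d (par t) = poly P t"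
    using polys_on_univariate[OF d(1)] by blast
  have roots: "poly P 0 = 0" "poly P 1 = 0" using bspec[OF P(2), of 0] bspec[OF P(2), of 1] d(2,3) by (simp_all add: par_ends)
  obtain P1 where P1: "P = [:0, 1:] * P1"
    using roots(1) unfolding poly_eq_0_iff_dvd by (auto elim: dvdE)
  have "poly P1 1 = 0" using roots(2) P1 by simp
  then obtain P2 where P2: "P1 = [:-1, 1:] * P2"
    unfolding poly_eq_0_iff_dvd by (auto elim: dvdE)
  \<comment> \<open>The sign makes the bubble \<open>t (1 - t)\<close> nonnegative.\<close>
  define Q where "Q = - P2"
  have PQ: "P = [:0, 1:] * ([:1, -1:] * Q)" unfolding P1 P2 Q_def by simp
  have "coeff Q i = 0" if i: "int k - 1 < int i" for i
  proof (cases "Q = 0")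
    case False
    then have Q1: "[:1, -1:] * Q \<noteq> 0" by (simp del: mult_pCons_left)
    have "degree P = degree [:0, 1::real:] + degree ([:1, -1:] * Q)"
      unfolding PQ using Q1 by (intro degree_mult_eq) auto
    also have "degree ([:1, -1:] * Q) = degree [:1, -1::real:] + degree Q"
      using False by (intro degree_mult_eq) auto
    finally have "degree P = degree Q + 2" by simp
    moreover have "coeff P (degree P) \<noteq> 0"
      using Q1 unfolding PQ by (simp del: mult_pCons_left)
    ultimately have "\<not> int k + 1 < int (degree Q + 2)" using P(1) by metis
    then have "degree Q < i" using i by simp
    then show ?thesis by (rule coeff_eq_0)
  qed simp
  then have r: "(\<lambda>x. if x \<in> closure E then poly Q (coord x) else 0) \<in> polys_on (int k - 1) E"
    by (rule univariate_polys_on)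
  define r where "r = (\<lambda>x. if x \<in> closure E then poly Q (coord x) else 0)"
  have factor: "d y = coord y * (1 - coord y) * r y" if "y \<in> closure E" for y
  proof -
    have "d y = poly P (coord y)" using bspec[OF P(2), of "coord y"] par_coord[OF that] coord_bounds[OF that] by simp
    then show ?thesis using that unfolding PQ r_def by (simp add: algebra_simps)
  qed
  have "d x * r x = 0"
  proof (rule integral_0_imp_0[of "\<lambda>x. d x * r x"])
    show "continuous_on (closure E) (\<lambda>x. d x * r x)"
      using polys_on_continuous[OF d(1) subset_refl] polys_on_continuous[OF r subset_refl]
      unfolding r_def by (rule continuous_on_mult)
    show "0 \<le> d y * r y" if "y \<in> closure E" for y
      using coord_bounds[OF that] factor[OF that] by (simp add: mult.assoc)
    show "edge_integral E (\<lambda>x. d x * r x) = 0" using orth[OF r] unfolding r_def .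
  qed (rule x)
  then show ?thesis using factor[OF x] by auto
qed

text \<open>
  Existence comes from the ansatz \<open>l + w q\<close>: the affine function \<open>l\<close> interpolates the vertex values,
  the bubble \<open>w = t (1 - t)\<close> does not disturb them, and \<open>q\<close> of degree \<open>k - 1\<close> is found by \<open>L\<^sup>2\<close>
  representation with weight \<open>w\<close> so as to match the prescribed moments.
  Uniqueness is \<open>edge_unisolvence\<close>.
\<close>

lemma edge_rec_in_polys:
  assumes dof: "edge_dof v E \<in> polys_on (int k - 1) E"
  shows "edge_rec k E v \<in> polys_on (int k + 1) E"
proof -
  let ?P = "\<lambda>p. p \<in> polys_on (int k + 1) E \<and> (\<forall>V\<in>endpoints E. p V = vert_dof v V) \<and>
        edge_projection (int k - 1) E p = edge_dof v E"
  note cont = polys_on_continuous[OF _ subset_refl]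
  define w where "w x = coord x * (1 + (-1) * coord x)" for x
  define l where "l x = vert_dof v a + (vert_dof v b - vert_dof v a) * coord x" for x
  have w: "w \<in> polynomials 2"
    unfolding w_def using polynomials_mult[OF coord_polynomial
        polynomials_axpy[OF polynomials_const[of 1 1] coord_polynomial, of "-1"]] by simp
  have l: "l \<in> polynomials 1"
    unfolding l_def by (intro polynomials_axpy polynomials_const coord_polynomial) simp
  have f: "continuous_on (closure E) (\<lambda>x. edge_dof v E x - l x)"
    using cont[OF dof] polynomials_continuous[OF l] by (intro continuous_intros)
  have "0 \<le> w x" if "x \<in> closure E" for x using coord_bounds[OF that] by (simp add: w_def)
  moreover have "0 < w x" if "x \<in> E" for x using coord_bounds_open[OF that] by (simp add: w_def)
  ultimately obtain q where q: "q \<in> polys_on (int k - 1) E"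
    "\<forall>r\<in>polys_on (int k - 1) E. edge_integral E (\<lambda>x. w x * (q x * r x))
      = edge_integral E (\<lambda>x. (edge_dof v E x - l x) * r x)"
    using poly_L2_representation[OF polynomials_continuous[OF w] _ _ f] by blast
  obtain q0 where q0: "q0 \<in> polynomials (int k - 1)" "q = (\<lambda>x. if x \<in> closure E then q0 x else 0)"
    using q(1) by (rule polys_onE)
  define p where "p = (\<lambda>x. if x \<in> closure E then l x + 1 * (w x * q0 x) else 0)"
  have p: "p \<in> polys_on (int k + 1) E" unfolding p_def
  proof (intro polys_onI polynomials_axpy)
    show "l \<in> polynomials (int k + 1)" by (rule polynomials_mono[OF l]) simp
    show "(\<lambda>x. w x * q0 x) \<in> polynomials (int k + 1)"
      using polynomials_mult[OF w q0(1)] by (simp add: add.commute)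
  qed
  have "edge_projection (int k - 1) E p = edge_dof v E"
    unfolding edge_projection_eq_iff[OF cont[OF p] dof]
  proof
    fix r assume r: "r \<in> polys_on (int k - 1) E"
    have "edge_integral E (\<lambda>x. (p x - edge_dof v E x) * r x)
      = edge_integral E (\<lambda>x. w x * (q x * r x) + (-1) * ((edge_dof v E x - l x) * r x))"
      by (intro integral_cong) (simp add: p_def q0(2) algebra_simps)
    also have "\<dots> = edge_integral E (\<lambda>x. w x * (q x * r x))
        + (-1) * edge_integral E (\<lambda>x. (edge_dof v E x - l x) * r x)"
      by (intro integral_axpy continuous_on_mult polynomials_continuous[OF w] cont[OF q(1)] cont[OF r] f)
    also have "\<dots> = 0" using q(2) r by simp
    finally show "edge_integral E (\<lambda>x. (p x - edge_dof v E x) * r x) = 0" .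
  qed
  moreover have "\<forall>V\<in>endpoints E. p V = vert_dof v V"
    unfolding endpoints_eq p_def using ends_in_closure coord_ends by (simp add: l_def w_def)
  ultimately have Pp: "?P p" using p by blast
  have uniq: "p' = p" if p': "?P p'" for p'
  proof (rule polys_on_eqI)
    show "p' \<in> polys_on (int k + 1) E" "p \<in> polys_on (int k + 1) E" using p p' by auto
    fix x assume x: "x \<in> closure E"
    have proj: "edge_integral E (\<lambda>x. (s x - edge_dof v E x) * r x) = 0"
      if "?P s" "r \<in> polys_on (int k - 1) E" for s r
      using that edge_projection_eq_iff[OF cont[of s] dof] by blast
    have "p' x - p x = 0"
    proof (rule edge_unisolvence[of "\<lambda>x. p' x - p x" k])
      show "(\<lambda>x. p' x - p x) \<in> polys_on (int k + 1) E" using polys_on_diff p p' by blast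
      show "p' a - p a = 0" "p' b - p b = 0" using p' Pp unfolding endpoints_eq by auto
      fix r assume r: "r \<in> polys_on (int k - 1) E"
      have "edge_integral E (\<lambda>x. (p' x - p x) * r x)
        = edge_integral E (\<lambda>x. (p' x - edge_dof v E x) * r x + (-1) * ((p x - edge_dof v E x) * r x))"
        by (intro integral_cong) (simp add: algebra_simps)
      also have "\<dots> = edge_integral E (\<lambda>x. (p' x - edge_dof v E x) * r x)
          + (-1) * edge_integral E (\<lambda>x. (p x - edge_dof v E x) * r x)"
        using p' p by (intro integral_axpy continuous_on_mult continuous_on_diff cont[OF r] cont[OF dof])
           (auto intro: cont)
      also have "\<dots> = 0" using proj[OF p' r] proj[OF Pp r] by simp
      finally show "edge_integral E (\<lambda>x. (p' x - p x) * r x) = 0" .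
    qed (rule x)
    then show "p' x = p x" by simp
  qed
  have "edge_rec k E v = p" unfolding edge_rec_def by (rule the_equality[of ?P, OF Pp uniq])
  then show ?thesis using p by simp
qed

end

section \<open>Reconstruction of gradients\<close>

lemma straight_edgeE:
  assumes "straight_edge E" obtains a b where "edge E a b"
proof -
  have "\<exists>p. case p of (a, b) \<Rightarrow> a \<noteq> b \<and> E = open_segment a b"
    using assms unfolding straight_edge_def by auto
  then have "case edge_ends E of (a, b) \<Rightarrow> a \<noteq> b \<and> E = open_segment a b"
    unfolding edge_ends_def by (rule someI_ex)
  then have "edge E (fst (edge_ends E)) (snd (edge_ends E))"
    by unfold_locales (auto split: prod.splits)
  then show ?thesis by (rule that)
qed

lemma vector_polys_onD: "\<tau> \<in> vector_polys_on m X \<Longrightarrow> (\<lambda>x. \<tau> x $ i) \<in> polys_on m X"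
  unfolding vector_polys_on_def by blast

lemma vector_polys_on_axpy:
  assumes "\<sigma> \<in> vector_polys_on m X" "\<tau> \<in> vector_polys_on m X"
  shows "(\<lambda>x. \<sigma> x + c *\<^sub>R \<tau> x) \<in> vector_polys_on m X"
  using polys_on_axpy[OF vector_polys_onD[OF assms(1)] vector_polys_onD[OF assms(2)]]
  unfolding vector_polys_on_def by simp

lemma vector_polys_on_continuous:
  assumes "\<tau> \<in> vector_polys_on m X" "S \<subseteq> closure X" shows "continuous_on S \<tau>"
proof -
  have "continuous_on S (\<lambda>x. \<chi> i. \<tau> x $ i)"
    by (intro continuous_on_vec_lambda polys_on_continuous[OF vector_polys_onD[OF assms(1)] assms(2)])
  then show ?thesis by simp
qed

lemma vector_polys_on_inner:
  assumes "\<tau> \<in> vector_polys_on m X" shows "(\<lambda>x. \<tau> x \<bullet> n) \<in> polys_on m X"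
proof -
  have "(\<lambda>x. (0 + n $ 1 * \<tau> x $ 1) + n $ 2 * \<tau> x $ 2) \<in> polys_on m X"
    using polys_onI[OF polynomials_zero, of X m] vector_polys_onD[OF assms]
    by (intro polys_on_axpy) simp_all
  then show ?thesis by (simp add: inner_vec_def sum_2 mult.commute)
qed

lemma vector_polys_on_eq_span:
  "vector_polys_on m X = fun_span (exponents m \<times> UNIV)
     (\<lambda>(e, l) x. (if x \<in> closure X then monomial e x else 0) *\<^sub>R axis l 1)"
proof -
  let ?g = "\<lambda>e x. if x \<in> closure X then monomial e x else 0"
  have comp: "(\<Sum>i\<in>exponents m \<times> UNIV. c i *\<^sub>R (case i of (e, l) \<Rightarrow> \<lambda>x. ?g e x *\<^sub>R axis l 1) x) $ j
      = (\<Sum>e\<in>exponents m. c (e, j) *\<^sub>R ?g e x)" for c and x :: point and j :: 2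
  proof -
    have "(\<Sum>i\<in>exponents m \<times> UNIV. c i *\<^sub>R (case i of (e, l) \<Rightarrow> \<lambda>x. ?g e x *\<^sub>R axis l 1) x) $ j
      = (\<Sum>e\<in>exponents m. \<Sum>l\<in>UNIV. (c (e, l) *\<^sub>R (?g e x *\<^sub>R axis l 1)) $ j)"
      by (simp add: sum.cartesian_product case_prod_unfold)
    also have "\<dots> = (\<Sum>e\<in>exponents m. c (e, j) *\<^sub>R ?g e x)"
      by (intro sum.cong refl) (simp add: axis_def if_distrib cong: if_cong)
    finally show ?thesis .
  qed
  show ?thesis
  proof (intro set_eqI iffI)
    fix \<tau> assume \<tau>: "\<tau> \<in> vector_polys_on m X"
    have "\<forall>j. \<exists>c. (\<lambda>x. \<tau> x $ j) = (\<lambda>x. \<Sum>e\<in>exponents m. c e *\<^sub>R ?g e x)"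
      using vector_polys_onD[OF \<tau>] unfolding polys_on_eq_span fun_span_def by simp
    then obtain c where c: "\<And>j. (\<lambda>x. \<tau> x $ j) = (\<lambda>x. \<Sum>e\<in>exponents m. c j e *\<^sub>R ?g e x)"
      by metis
    have "\<tau> x = (\<Sum>i\<in>exponents m \<times> UNIV. c (snd i) (fst i) *\<^sub>R
        (case i of (e, l) \<Rightarrow> \<lambda>x. ?g e x *\<^sub>R axis l 1) x)" for x
      using fun_cong[OF c] comp[of "\<lambda>i. c (snd i) (fst i)" x] by (simp add: vec_eq_iff)
    then show "\<tau> \<in> fun_span (exponents m \<times> UNIV) (\<lambda>(e, l) x. ?g e x *\<^sub>R axis l 1)"
      unfolding fun_span_def by (intro CollectI exI[of _ "\<lambda>i. c (snd i) (fst i)"]) auto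
  next
    fix \<tau> :: "point \<Rightarrow> point"
    assume "\<tau> \<in> fun_span (exponents m \<times> UNIV) (\<lambda>(e, l) x. ?g e x *\<^sub>R axis l 1)"
    then obtain c where "\<tau> = (\<lambda>x. \<Sum>i\<in>exponents m \<times> UNIV. c i *\<^sub>R
        (case i of (e, l) \<Rightarrow> \<lambda>x. ?g e x *\<^sub>R axis l 1) x)"
      unfolding fun_span_def by blast
    then have "(\<lambda>x. \<tau> x $ j) = (\<lambda>x. \<Sum>e\<in>exponents m. c (e, j) *\<^sub>R ?g e x)" for j
      by (simp only: comp)
    then have "(\<lambda>x. \<tau> x $ j) \<in> polys_on m X" for j
      unfolding polys_on_eq_span fun_span_def by (intro CollectI exI[of _ "\<lambda>e. c (e, j)"]) simp
    then show "\<tau> \<in> vector_polys_on m X" unfolding vector_polys_on_def by simp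
  qed
qed

text \<open>
  The divergence at a point of \<open>T\<close> only sees a neighbourhood inside the open set \<open>T\<close>, where the field
  is a genuine polynomial in spite of its zero extension.
\<close>

lemma vector_polys_on_divergence:
  assumes \<tau>: "\<tau> \<in> vector_polys_on m T" and "open T"
  shows "\<exists>D. continuous_on UNIV D \<and> (\<forall>x\<in>T. \<tau> differentiable (at x) \<and> divergence \<tau> x = D x)"
proof -
  obtain p where p: "p \<in> polynomials m" "(\<lambda>x. \<tau> x $ 1) = (\<lambda>x. if x \<in> closure T then p x else 0)"
    using vector_polys_onD[OF \<tau>] by (rule polys_onE)
  obtain q where q: "q \<in> polynomials m" "(\<lambda>x. \<tau> x $ 2) = (\<lambda>x. if x \<in> closure T then q x else 0)"
    using vector_polys_onD[OF \<tau>] by (rule polys_onE)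
  obtain p1 p2 where dp: "continuous_on UNIV p1"
    "\<forall>x. (p has_derivative (\<lambda>h. p1 x * h $ 1 + p2 x * h $ 2)) (at x)"
    using polynomials_derivative[OF p(1)] by blast
  obtain q1 q2 where dq: "continuous_on UNIV q2"
    "\<forall>x. (q has_derivative (\<lambda>h. q1 x * h $ 1 + q2 x * h $ 2)) (at x)"
    using polynomials_derivative[OF q(1)] by blast
  have der: "(\<tau> has_derivative (\<lambda>h. (p1 x * h $ 1 + p2 x * h $ 2) *\<^sub>R axis 1 1
      + (q1 x * h $ 1 + q2 x * h $ 2) *\<^sub>R axis 2 1)) (at x)" if "x \<in> T" for x
  proof (rule has_derivative_transform_within_open[OF _ \<open>open T\<close> that])
    show "((\<lambda>x. p x *\<^sub>R axis 1 1 + q x *\<^sub>R axis 2 1) has_derivative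
        (\<lambda>h. (p1 x * h $ 1 + p2 x * h $ 2) *\<^sub>R axis 1 1 + (q1 x * h $ 1 + q2 x * h $ 2) *\<^sub>R axis 2 1)) (at x)"
      using dp(2) dq(2) by (intro has_derivative_add has_derivative_scaleR_left) auto
    fix y assume "y \<in> T"
    then have "y \<in> closure T" using closure_subset by blast
    then show "p y *\<^sub>R axis 1 1 + q y *\<^sub>R axis 2 1 = \<tau> y"
      using fun_cong[OF p(2), of y] fun_cong[OF q(2), of y] by (simp add: vec_eq_iff forall_2 axis_def)
  qed
  have "divergence \<tau> x = p1 x + q2 x" if "x \<in> T" for x
    unfolding divergence_def frechet_derivative_at[OF der[OF that], symmetric]
    by (simp add: sum_2 axis_def)
  moreover have "continuous_on UNIV (\<lambda>x. p1 x + q2 x)" using dp(1) dq(1) by (rule continuous_on_add)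
  ultimately show ?thesis using der unfolding differentiable_def by blast
qed

lemma divergence_axpy:
  assumes "\<sigma> differentiable (at x)" "\<tau> differentiable (at x)"
  shows "divergence (\<lambda>x. \<sigma> x + c *\<^sub>R \<tau> x) x = divergence \<sigma> x + c * divergence \<tau> x"
proof -
  have "((\<lambda>x. \<sigma> x + c *\<^sub>R \<tau> x) has_derivative
      (\<lambda>h. frechet_derivative \<sigma> (at x) h + c *\<^sub>R frechet_derivative \<tau> (at x) h)) (at x)"
    using assms unfolding frechet_derivative_works
    by (intro has_derivative_add has_derivative_scaleR_right)
  then show ?thesis
    unfolding divergence_def frechet_derivative_at[symmetric]
    by (simp add: frechet_derivative_at[symmetric] sum.distrib sum_distrib_left)
qed

locale element =
  fixes T :: "point set"
  assumes open_T: "open T" and bounded_T: "bounded T"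
begin

lemma compact_closure: "compact (closure T)"
  using bounded_T by simp

lemma integrable_T:
  fixes f :: "point \<Rightarrow> real"
  shows "continuous_on (closure T) f \<Longrightarrow> set_integrable lborel T f"
  by (rule set_integrable_continuous[OF compact_closure _ closure_subset]) (use open_T in auto)

lemma integral_cong:
  assumes "\<And>x. x \<in> T \<Longrightarrow> f x = g x" shows "element_integral T f = element_integral T g"
  unfolding element_integral_def by (rule set_lebesgue_integral_cong) (use assms open_T in auto)

lemma integral_axpy:
  assumes "continuous_on (closure T) f" "continuous_on (closure T) g"
  shows "element_integral T (\<lambda>x. f x + c * g x) = element_integral T f + c * element_integral T g"
proof -
  have "set_integrable lborel T (\<lambda>x. c * g x)"
    using assms(2) by (intro integrable_T continuous_intros)
  then show ?thesis unfolding element_integral_def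
    using set_integral_add(2)[OF integrable_T[OF assms(1)], of "\<lambda>x. c * g x"] by simp
qed

lemma integral_mono:
  assumes "continuous_on (closure T) f" "continuous_on (closure T) g" "\<And>x. x \<in> T \<Longrightarrow> f x \<le> g x"
  shows "element_integral T f \<le> element_integral T g"
proof -
  have "0 \<le> element_integral T (\<lambda>x. g x + (-1) * f x)"
    by (rule element_integral_nonneg) (use assms(3) in auto)
  then show ?thesis using integral_axpy[OF assms(2,1), of "-1"] by simp
qed

lemma vector_L2_definite:
  assumes "G \<in> vector_polys_on m T" "element_integral T (\<lambda>x. G x \<bullet> G x) = 0"
  shows "G = (\<lambda>x. 0)"
proof
  fix x
  have c: "continuous_on (closure T) (\<lambda>x. G x \<bullet> G x)"
    using vector_polys_on_continuous[OF assms(1) subset_refl] by (intro continuous_intros)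
  show "G x = 0"
  proof (cases "x \<in> closure T")
    case True
    have "G x \<bullet> G x = 0"
      by (rule set_integral_0_imp_0[OF compact_closure c closure_subset _ _ _ open_T subset_refl True])
         (use assms(2) open_T in \<open>auto simp: element_integral_def\<close>)
    then show ?thesis by simp
  next
    case False
    then show ?thesis using polys_on_outside[OF vector_polys_onD[OF assms(1)]] by (simp add: vec_eq_iff)
  qed
qed

text \<open>
  The right-hand side defining the reconstructed gradient is a linear functional of the test field:
  the divergence is integrable, and so are the edge terms because the edge reconstructions are
  polynomials.  Hence it has a unique representative.
\<close>

lemma gradient_rec_in_polys:
  assumes elem: "elem_dof v T \<in> polys_on (int k - 1) T"
    and edges: "\<And>E. E \<in> edges_of M T \<Longrightarrow> straight_edge E"
      "\<And>E. E \<in> edges_of M T \<Longrightarrow> closure E \<subseteq> closure T"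
      "\<And>E. E \<in> edges_of M T \<Longrightarrow> edge_dof v E \<in> polys_on (int k - 1) E"
  shows "gradient_rec M k T v \<in> vector_polys_on (int k) T"
proof -
  let ?V = "vector_polys_on (int k) T"
  let ?L = "\<lambda>\<tau>. - element_integral T (\<lambda>x. elem_dof v T x * divergence \<tau> x) + boundary_term M k T v \<tau>"
  let ?B = "\<lambda>\<sigma> \<tau>. element_integral T (\<lambda>x. \<sigma> x \<bullet> \<tau> x)"
  note cont = vector_polys_on_continuous[OF _ subset_refl]
  have inner_axpy: "?B G (\<lambda>x. \<sigma> x + c *\<^sub>R \<tau> x) = ?B G \<sigma> + c * ?B G \<tau>"
    if "G \<in> ?V" "\<sigma> \<in> ?V" "\<tau> \<in> ?V" for G \<sigma> \<tau> c
  proof -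
    have "?B G (\<lambda>x. \<sigma> x + c *\<^sub>R \<tau> x) = element_integral T (\<lambda>x. G x \<bullet> \<sigma> x + c * (G x \<bullet> \<tau> x))"
      by (simp add: inner_add_right)
    also have "\<dots> = ?B G \<sigma> + c * ?B G \<tau>"
      using that by (intro integral_axpy continuous_on_inner cont)
    finally show ?thesis .
  qed
  have div_axpy: "element_integral T (\<lambda>x. elem_dof v T x * divergence (\<lambda>x. \<sigma> x + c *\<^sub>R \<tau> x) x)
      = element_integral T (\<lambda>x. elem_dof v T x * divergence \<sigma> x)
        + c * element_integral T (\<lambda>x. elem_dof v T x * divergence \<tau> x)"
    if V: "\<sigma> \<in> ?V" "\<tau> \<in> ?V" for \<sigma> \<tau> c
  proof -
    obtain D where D: "continuous_on UNIV D"
      "\<forall>x\<in>T. \<sigma> differentiable (at x) \<and> divergence \<sigma> x = D x"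
      using vector_polys_on_divergence[OF V(1) open_T] by blast
    obtain D' where D': "continuous_on UNIV D'"
      "\<forall>x\<in>T. \<tau> differentiable (at x) \<and> divergence \<tau> x = D' x"
      using vector_polys_on_divergence[OF V(2) open_T] by blast
    note el = polys_on_continuous[OF elem subset_refl]
    have "element_integral T (\<lambda>x. elem_dof v T x * divergence (\<lambda>x. \<sigma> x + c *\<^sub>R \<tau> x) x)
      = element_integral T (\<lambda>x. elem_dof v T x * D x + c * (elem_dof v T x * D' x))"
      using D(2) D'(2) by (intro integral_cong) (simp add: divergence_axpy algebra_simps)
    also have "\<dots> = element_integral T (\<lambda>x. elem_dof v T x * D x)
        + c * element_integral T (\<lambda>x. elem_dof v T x * D' x)"
      by (intro integral_axpy continuous_on_mult el continuous_on_subset[OF D(1)]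
          continuous_on_subset[OF D'(1)]) auto
    also have "element_integral T (\<lambda>x. elem_dof v T x * D x)
        = element_integral T (\<lambda>x. elem_dof v T x * divergence \<sigma> x)"
      using D(2) by (intro integral_cong) simp
    also have "element_integral T (\<lambda>x. elem_dof v T x * D' x)
        = element_integral T (\<lambda>x. elem_dof v T x * divergence \<tau> x)"
      using D'(2) by (intro integral_cong) simp
    finally show ?thesis .
  qed
  have boundary_axpy: "boundary_term M k T v (\<lambda>x. \<sigma> x + c *\<^sub>R \<tau> x)
      = boundary_term M k T v \<sigma> + c * boundary_term M k T v \<tau>"
    if V: "\<sigma> \<in> ?V" "\<tau> \<in> ?V" for \<sigma> \<tau> c
  proof -
    have "edge_integral E (\<lambda>x. edge_rec k E v x * ((\<sigma> x + c *\<^sub>R \<tau> x) \<bullet> normal M E))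
      = edge_integral E (\<lambda>x. edge_rec k E v x * (\<sigma> x \<bullet> normal M E))
        + c * edge_integral E (\<lambda>x. edge_rec k E v x * (\<tau> x \<bullet> normal M E))"
      if E: "E \<in> edges_of M T" for E
    proof -
      obtain a b where "edge E a b" using edges(1)[OF E] by (rule straight_edgeE)
      then interpret E: edge E a b .
      note rec = polys_on_continuous[OF E.edge_rec_in_polys[OF edges(3)[OF E]] subset_refl]
      have "edge_integral E (\<lambda>x. edge_rec k E v x * ((\<sigma> x + c *\<^sub>R \<tau> x) \<bullet> normal M E))
        = edge_integral E (\<lambda>x. edge_rec k E v x * (\<sigma> x \<bullet> normal M E)
            + c * (edge_rec k E v x * (\<tau> x \<bullet> normal M E)))"
        by (simp add: inner_add_left algebra_simps)
      also have "\<dots> = edge_integral E (\<lambda>x. edge_rec k E v x * (\<sigma> x \<bullet> normal M E))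
        + c * edge_integral E (\<lambda>x. edge_rec k E v x * (\<tau> x \<bullet> normal M E))"
        using V edges(2)[OF E]
        by (intro E.integral_axpy continuous_on_mult rec continuous_on_inner continuous_on_const
            vector_polys_on_continuous)
      finally show ?thesis .
    qed
    then show ?thesis unfolding boundary_term_def
      by (simp add: sum_distrib_left sum.distrib[symmetric] algebra_simps)
  qed
  have "\<exists>G\<in>?V. \<forall>\<tau>\<in>?V. ?B G \<tau> = ?L \<tau>"
    unfolding vector_polys_on_eq_span
  proof (rule riesz_representation[where V = ?V and B = ?B and L = ?L])
    show "linear_on_fun ?V (?B G)" if "G \<in> ?V" for G
      unfolding linear_on_fun_def using inner_axpy[OF that] by blast
    show "linear_on_fun ?V ?L"
      unfolding linear_on_fun_def using div_axpy boundary_axpy by (simp add: algebra_simps)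
  qed (auto simp: vector_polys_on_eq_span[symmetric] finite_exponents inner_commute
      intro: vector_polys_on_axpy vector_L2_definite)
  then obtain G where G: "G \<in> ?V" "\<forall>\<tau>\<in>?V. ?B G \<tau> = ?L \<tau>" by (elim bexE)
  have "G' = G" if G': "G' \<in> ?V" "\<forall>\<tau>\<in>?V. ?B G' \<tau> = ?L \<tau>" for G'
  proof -
    define e where "e = (\<lambda>x. G' x + (-1) *\<^sub>R G x)"
    have e: "e \<in> ?V" unfolding e_def using vector_polys_on_axpy G'(1) G(1) by blast
    have "?B e e = ?B e G' + (-1) * ?B e G"
      using inner_axpy[OF e G'(1) G(1), of "-1"] unfolding e_def .
    also have "\<dots> = 0" using bspec[OF G(2) e] bspec[OF G'(2) e] by (simp add: inner_commute)
    finally have e0: "e = (\<lambda>x. 0)" by (rule vector_L2_definite[OF e])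
    have "e x = 0" for x unfolding e0 ..
    then have "G' x = G x" for x by (simp add: e_def)
    then show ?thesis by (rule ext)
  qed
  then have uniq: "\<And>G'. G' \<in> ?V \<and> (\<forall>\<tau>\<in>?V. ?B G' \<tau> = ?L \<tau>) \<Longrightarrow> G' = G" by (elim conjE)
  have "gradient_rec M k T v = G"
    unfolding gradient_rec_def by (rule the_equality, rule conjI[OF G], rule uniq)
  then show ?thesis using G(1) by simp
qed

end

section \<open>Polygons near a common edge\<close>

text \<open>
  Whether a set contains or avoids everything near a point on the given side, as seen by a filter of
  half-disc neighbourhoods.  Unlike a description of polygons near an edge, this property passes
  through finite unions and intersections.
\<close>

definition germ_decided :: "'a::metric_space set \<Rightarrow> 'a filter \<Rightarrow> bool" where
  "germ_decided A F \<longleftrightarrow> (\<forall>\<^sub>F y in F. y \<in> A) \<or> (\<forall>\<^sub>F y in F. y \<notin> A)"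

abbreviation side_germ :: "point \<Rightarrow> point \<Rightarrow> point filter" where
  "side_germ n x \<equiv> at x within {y. 0 < n \<bullet> (y - x)}"

lemma germ_decided_Union:
  assumes "finite F" "\<And>A. A \<in> F \<Longrightarrow> germ_decided A G"
  shows "germ_decided (\<Union>F) G"
proof (cases "\<exists>A\<in>F. \<forall>\<^sub>F y in G. y \<in> A")
  case True
  then obtain A where "A \<in> F" "\<forall>\<^sub>F y in G. y \<in> A" by blast
  then have "\<forall>\<^sub>F y in G. y \<in> \<Union>F" by (auto elim: eventually_mono)
  then show ?thesis unfolding germ_decided_def by blast
next
  case False
  then have "\<forall>A\<in>F. \<forall>\<^sub>F y in G. y \<notin> A" using assms unfolding germ_decided_def by blast
  then have "\<forall>\<^sub>F y in G. \<forall>A\<in>F. y \<notin> A" using assms(1) by (simp add: eventually_ball_finite)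
  then show ?thesis unfolding germ_decided_def by (simp add: eventually_mono)
qed

lemma germ_decided_Inter:
  assumes "finite F" "\<And>A. A \<in> F \<Longrightarrow> germ_decided A G"
  shows "germ_decided (\<Inter>F) G"
proof -
  have "germ_decided (\<Union>(uminus ` F)) G"
  proof (rule germ_decided_Union)
    fix A' assume "A' \<in> uminus ` F"
    then obtain A where "A \<in> F" "A' = - A" by blast
    then show "germ_decided A' G" using assms(2)[of A] unfolding germ_decided_def by auto
  qed (use assms(1) in simp)
  then show ?thesis unfolding germ_decided_def by auto
qed

lemma plane_parallel:
  fixes c d n :: point
  assumes "d \<noteq> 0" "n \<bullet> d = 0" "norm n = 1" "c \<bullet> d = 0"
  shows "c = (c \<bullet> n) *\<^sub>R n"
proof -
  \<comment> \<open>The part of \<open>c\<close> orthogonal to \<open>n\<close> is orthogonal to both vectors of a basis of the plane.\<close>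
  define e where "e = c - (c \<bullet> n) *\<^sub>R n"
  have "e \<bullet> d = 0" using assms by (simp add: e_def inner_diff_left)
  have nn: "n \<bullet> n = 1" using assms(3) by (simp add: dot_square_norm)
  then have "e \<bullet> n = 0" by (simp add: e_def inner_diff_left)
  have 1: "e$1 * d$1 + e$2 * d$2 = 0" "e$1 * n$1 + e$2 * n$2 = 0" "n$1 * d$1 + n$2*d$2 = 0"
     "n$1 * n$1 + n$2*n$2 = 1"
    using \<open>e \<bullet> d = 0\<close> \<open>e \<bullet> n = 0\<close> assms(2) nn by (simp_all add: inner_vec_def sum_2)
  have "e$1 * (d$1 * n$2 - d$2 * n$1) = 0" "e$2 * (d$1 * n$2 - d$2 * n$1) = 0"
  proof -
    have "e$1 * (d$1 * n$2 - d$2 * n$1) = n$2 * (e$1 * d$1 + e$2 * d$2) - d$2 * (e$1 * n$1 + e$2 * n$2)"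
      by (simp add: algebra_simps)
    then show "e$1 * (d$1 * n$2 - d$2 * n$1) = 0" using 1 by simp
    have "e$2 * (d$1 * n$2 - d$2 * n$1) = d$1 * (e$1 * n$1 + e$2 * n$2) - n$1 * (e$1 * d$1 + e$2 * d$2)"
      by (simp add: algebra_simps)
    then show "e$2 * (d$1 * n$2 - d$2 * n$1) = 0" using 1 by simp
  qed
  moreover have "d$1 * n$2 - d$2 * n$1 \<noteq> 0"
  proof
    assume a: "d$1 * n$2 - d$2 * n$1 = 0"
    have "d$1 * (n$1 * n$1 + n$2 * n$2) = n$1 * (n$1 * d$1 + n$2 * d$2) + n$2 * (d$1 * n$2 - d$2 * n$1)"
      "d$2 * (n$1 * n$1 + n$2 * n$2) = n$2 * (n$1 * d$1 + n$2 * d$2) - n$1 * (d$1 * n$2 - d$2 * n$1)"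
      by (simp_all add: algebra_simps)
    then have "d$1 = 0" "d$2 = 0" unfolding 1(3,4) a by simp_all
    then show False using assms(1) by (simp add: vec_eq_iff forall_2)
  qed
  ultimately have "e = 0" by (simp add: vec_eq_iff forall_2)
  then show ?thesis by (simp add: e_def)
qed

text \<open>
  Away from its boundary line a half-plane is locally everything or nothing.  The boundary line
  either contains the edge, and then the half-plane lies on one side of the edge, or meets it in at most one point.
\<close>

lemma halfplane_decided_off_finite:
  fixes a b n c :: point
  assumes "a \<noteq> b" "n \<bullet> (b - a) = 0" "norm n = 1" "c \<noteq> 0"
  shows "finite {x \<in> open_segment a b. \<not> germ_decided {y. c \<bullet> y \<le> \<beta>} (side_germ n x)}"
proof -
  let ?bad = "{x \<in> open_segment a b. \<not> germ_decided {y. c \<bullet> y \<le> \<beta>} (side_germ n x)}"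
  let ?H = "{y. c \<bullet> y \<le> \<beta>}"
  have on_boundary: "c \<bullet> x = \<beta>" if "x \<in> ?bad" for x
  proof (rule ccontr)
    assume "c \<bullet> x \<noteq> \<beta>"
    have t: "((\<lambda>y. c \<bullet> y) \<longlongrightarrow> c \<bullet> x) (side_germ n x)" by (intro tendsto_intros)
    have "(\<forall>\<^sub>F y in side_germ n x. c \<bullet> y < \<beta>) \<or> (\<forall>\<^sub>F y in side_germ n x. c \<bullet> y > \<beta>)"
      using order_tendstoD(1)[OF t, of \<beta>] order_tendstoD(2)[OF t, of \<beta>] \<open>c \<bullet> x \<noteq> \<beta>\<close> by linarith
    then have "germ_decided ?H (side_germ n x)" unfolding germ_decided_def
    proof (elim disjE)
      assume "\<forall>\<^sub>F y in side_germ n x. c \<bullet> y < \<beta>"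
      then have "\<forall>\<^sub>F y in side_germ n x. y \<in> ?H" by (rule eventually_mono) simp
      then show "(\<forall>\<^sub>F y in side_germ n x. y \<in> ?H) \<or> (\<forall>\<^sub>F y in side_germ n x. y \<notin> ?H)" ..
    next
      assume "\<forall>\<^sub>F y in side_germ n x. c \<bullet> y > \<beta>"
      then have "\<forall>\<^sub>F y in side_germ n x. y \<notin> ?H" by (rule eventually_mono) simp
      then show "(\<forall>\<^sub>F y in side_germ n x. y \<in> ?H) \<or> (\<forall>\<^sub>F y in side_germ n x. y \<notin> ?H)" ..
    qed
    then show False using that by simp
  qed
  show ?thesis
  proof (cases "c \<bullet> (b - a) = 0")
    case True
    have cn: "c = (c \<bullet> n) *\<^sub>R n"
      using plane_parallel[OF _ assms(2,3) True] assms(1) by simp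
    have "germ_decided ?H (side_germ n x)" if "c \<bullet> x = \<beta>" for x
    proof -
      have *: "c \<bullet> y - \<beta> = (c \<bullet> n) * (n \<bullet> (y - x))" for y
      proof -
        have "c \<bullet> y - \<beta> = c \<bullet> (y - x)" using that by (simp add: inner_diff_right)
        also have "\<dots> = ((c \<bullet> n) *\<^sub>R n) \<bullet> (y - x)" by (rule arg_cong[OF cn])
        finally show ?thesis by simp
      qed
      have ev: "\<forall>\<^sub>F y in side_germ n x. 0 < n \<bullet> (y - x)" by (simp add: eventually_at_filter)
      show ?thesis
      proof (cases "c \<bullet> n \<le> 0")
        case True
        have "\<forall>\<^sub>F y in side_germ n x. y \<in> ?H"
          using ev
        proof eventually_elim
          case (elim y)
          then have "(c \<bullet> n) * (n \<bullet> (y - x)) \<le> 0" using True by (intro mult_nonpos_nonneg) auto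
          then show ?case using *[of y] by simp
        qed
        then show ?thesis unfolding germ_decided_def by blast
      next
        case False
        have "\<forall>\<^sub>F y in side_germ n x. y \<notin> ?H"
          using ev
        proof eventually_elim
          case (elim y)
          then have "0 < (c \<bullet> n) * (n \<bullet> (y - x))" using False by simp
          then show ?case using *[of y] by simp
        qed
        then show ?thesis unfolding germ_decided_def by blast
      qed
    qed
    then have "?bad \<subseteq> {}" using on_boundary by blast
    then show ?thesis by (rule finite_subset) simp
  next
    case False
    have "x = y" if bad: "x \<in> ?bad" "y \<in> ?bad" for x y
    proof -
      obtain s t where st: "x = (1-s) *\<^sub>R a + s *\<^sub>R b" "y = (1-t) *\<^sub>R a + t *\<^sub>R b"
        using bad by (auto simp: in_segment)
      have "c \<bullet> x - c \<bullet> y = (s - t) * (c \<bullet> (b - a))"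
        unfolding st by (simp add: inner_diff_right inner_add_right algebra_simps)
      then have "s = t" using on_boundary[OF bad(1)] on_boundary[OF bad(2)] False by simp
      then show ?thesis using st by simp
    qed
    then have "\<exists>z. ?bad \<subseteq> {z}" by blast
    then show ?thesis using finite_subset by blast
  qed
qed

lemma polyhedron_decided_off_finite:
  fixes a b n :: point
  assumes "a \<noteq> b" "n \<bullet> (b - a) = 0" "norm n = 1" "polyhedron \<tau>"
  shows "finite {x \<in> open_segment a b. \<not> germ_decided \<tau> (side_germ n x)}"
proof -
  obtain H where H: "finite H" "\<tau> = \<Inter>H" "\<And>h. h \<in> H \<Longrightarrow> \<exists>c \<beta>. c \<noteq> 0 \<and> h = {y. c \<bullet> y \<le> \<beta>}"
    using assms(4) unfolding polyhedron_def by blast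
  have "{x \<in> open_segment a b. \<not> germ_decided \<tau> (side_germ n x)}
    \<subseteq> (\<Union>h\<in>H. {x \<in> open_segment a b. \<not> germ_decided h (side_germ n x)})"
    unfolding H(2) using germ_decided_Inter[OF H(1)] by blast
  moreover have "finite {x \<in> open_segment a b. \<not> germ_decided h (side_germ n x)}" if "h \<in> H" for h
    using H(3)[OF that] halfplane_decided_off_finite[OF assms(1-3)] by blast
  ultimately show ?thesis using H(1) by (meson finite_UN_I finite_subset)
qed

lemma eventually_side_germ:
  "(\<forall>\<^sub>F y in side_germ n x. P y) \<longleftrightarrow> (\<exists>r>0. \<forall>y\<in>ball x r. 0 < n \<bullet> (y - x) \<longrightarrow> P y)"
  unfolding eventually_at by (intro ex_cong1 conj_cong refl) (auto simp: dist_commute)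

lemma germ_decided_interior:
  assumes "germ_decided P (side_germ n x)"
  shows "germ_decided (interior P) (side_germ n x)"
proof -
  have "\<forall>\<^sub>F y in side_germ n x. y \<in> interior P" if inP: "\<forall>\<^sub>F y in side_germ n x. y \<in> P"
  proof -
    obtain r where r: "r > 0" "\<forall>y\<in>ball x r. 0 < n \<bullet> (y - x) \<longrightarrow> y \<in> P"
      using inP unfolding eventually_side_germ by blast
    have "open (ball x r \<inter> {y. n \<bullet> x < n \<bullet> y})" by (intro open_Int open_ball open_halfspace_gt)
    moreover have "ball x r \<inter> {y. n \<bullet> x < n \<bullet> y} \<subseteq> P" using r(2) by (auto simp: inner_diff_right)
    ultimately have "ball x r \<inter> {y. n \<bullet> x < n \<bullet> y} \<subseteq> interior P" by (rule interior_maximal[rotated])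
    then show ?thesis unfolding eventually_side_germ using r(1)
      by (auto simp: inner_diff_right intro!: exI[of _ r])
  qed
  moreover have "\<forall>\<^sub>F y in side_germ n x. y \<notin> interior P" if "\<forall>\<^sub>F y in side_germ n x. y \<notin> P"
    using that by (rule eventually_mono) (use interior_subset in blast)
  ultimately show ?thesis using assms unfolding germ_decided_def by blast
qed

lemma polygon_decided_off_finite:
  fixes a b n :: point
  assumes "a \<noteq> b" "n \<bullet> (b - a) = 0" "norm n = 1" "polygonal_domain T"
  shows "finite {x \<in> open_segment a b. \<not> germ_decided T (side_germ n x)}"
proof -
  obtain F where F: "finite F" "\<forall>\<tau>\<in>F. 2 simplex \<tau>" "T = interior (\<Union>F)"
    using assms(4) unfolding polygonal_domain_def by (elim conjE exE)
  have "{x \<in> open_segment a b. \<not> germ_decided T (side_germ n x)}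
    \<subseteq> (\<Union>\<tau>\<in>F. {x \<in> open_segment a b. \<not> germ_decided \<tau> (side_germ n x)})"
  proof
    fix x assume x: "x \<in> {x \<in> open_segment a b. \<not> germ_decided T (side_germ n x)}"
    then have "\<not> germ_decided (\<Union>F) (side_germ n x)" using germ_decided_interior F(3) by auto
    then obtain \<tau> where "\<tau> \<in> F" "\<not> germ_decided \<tau> (side_germ n x)"
      using germ_decided_Union[OF F(1)] by metis
    then show "x \<in> (\<Union>\<tau>\<in>F. {x \<in> open_segment a b. \<not> germ_decided \<tau> (side_germ n x)})" using x by auto
  qed
  moreover have "finite {x \<in> open_segment a b. \<not> germ_decided \<tau> (side_germ n x)}" if "\<tau> \<in> F" for \<tau>
    using polyhedron_decided_off_finite[OF assms(1-3)] F(2) that simplex_imp_polytope[of 2 \<tau>]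
      polytope_imp_polyhedron[of \<tau>] by simp
  ultimately show ?thesis using F(1) by (meson finite_UN_I finite_subset)
qed

lemma polygon_open: "polygonal_domain T \<Longrightarrow> open T"
  unfolding polygonal_domain_def by auto

lemma polygonal_domain_nonempty: "polygonal_domain T \<Longrightarrow> T \<noteq> {}"
  and polygonal_domain_connected: "polygonal_domain T \<Longrightarrow> connected T"
  unfolding polygonal_domain_def by auto

lemma polygon_compact_hull:
  assumes "polygonal_domain T"
  obtains P where "compact P" "T = interior P"
proof -
  obtain F where F: "finite F" "\<forall>\<tau>\<in>F. 2 simplex \<tau>" "T = interior (\<Union>F)"
    using assms unfolding polygonal_domain_def by (elim conjE exE)
  have "compact (\<Union>F)" using F(1,2) simplex_imp_polytope polytope_imp_compact by (intro compact_Union) blast+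
  then show ?thesis using that F(3) by blast
qed

lemma polygon_bounded: "polygonal_domain T \<Longrightarrow> bounded T"
  by (metis polygon_compact_hull compact_imp_bounded bounded_subset interior_subset)

lemma polygon_interior_closure:
  assumes "polygonal_domain T" shows "interior (closure T) = T"
proof -
  obtain P where P: "compact P" "T = interior P" using polygon_compact_hull[OF assms] .
  then have "closure T \<subseteq> P" by (simp add: closure_minimal compact_imp_closed interior_subset)
  then show ?thesis using P(2) polygon_open[OF assms] interior_mono
    by (metis closure_subset interior_maximal subset_antisym)
qed

lemma open_meets_off_line:
  fixes n :: point
  assumes "open U" "U \<noteq> {}" "norm n = 1"
  shows "\<exists>y\<in>U. n \<bullet> (y - x) \<noteq> 0"
proof -
  obtain y where "y \<in> U" using assms(2) by blast
  obtain e where e: "e > 0" "cball y e \<subseteq> U" using assms(1) \<open>y \<in> U\<close> open_contains_cball by blast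
  have nn: "n \<bullet> n = 1" using assms(3) by (simp add: dot_square_norm)
  have "y + e *\<^sub>R n \<in> U" using e assms(3) by (auto simp: dist_norm)
  moreover have "n \<bullet> (y + e *\<^sub>R n - x) = n \<bullet> (y - x) + e" using nn by (simp add: algebra_simps inner_add_right inner_diff_right)
  ultimately show ?thesis using \<open>y \<in> U\<close> e(1) by (metis add_0 less_numeral_extra(3))
qed

lemma frontier_open_meets:
  assumes "open T" "x \<in> closure T" "open U" "x \<in> U"
  shows "open (T \<inter> U)" "T \<inter> U \<noteq> {}"
  using assms open_Int_closure_eq_empty[OF assms(3), of T] by auto

lemma decided_frontier_half:
  assumes "open T" "x \<in> closure T" "norm n = 1"
    and "germ_decided T (side_germ n x)" "germ_decided T (side_germ (-n) x)"
  shows "(\<forall>\<^sub>F y in side_germ n x. y \<in> T) \<or> (\<forall>\<^sub>F y in side_germ (-n) x. y \<in> T)"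
proof (rule ccontr)
  assume "\<not> ?thesis"
  then have "\<forall>\<^sub>F y in side_germ n x. y \<notin> T" "\<forall>\<^sub>F y in side_germ (-n) x. y \<notin> T"
    using assms unfolding germ_decided_def by auto
  then obtain r s where r: "r > 0" "\<forall>y\<in>ball x r. 0 < n \<bullet> (y - x) \<longrightarrow> y \<notin> T"
    and s: "s > 0" "\<forall>y\<in>ball x s. 0 < (-n) \<bullet> (y - x) \<longrightarrow> y \<notin> T"
    unfolding eventually_side_germ by blast
  have "open (T \<inter> ball x (min r s))" "T \<inter> ball x (min r s) \<noteq> {}"
    using frontier_open_meets[OF assms(1,2), of "ball x (min r s)"] r s by auto
  then obtain y where y: "y \<in> T" "y \<in> ball x (min r s)" "n \<bullet> (y - x) \<noteq> 0"
    using open_meets_off_line[OF _ _ assms(3)] by blast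
  then have "0 < n \<bullet> (y - x) \<or> 0 < (-n) \<bullet> (y - x)" by (simp add: inner_minus_left) linarith
  then show False using y r(2) s(2) by auto
qed

text \<open>
  At all but finitely many points of a common edge each polygon is decided on both sides.  Both
  contain the point in their closure, so each fills at least one of the two half-discs, and being
  disjoint they fill different ones.
\<close>

lemma adjacent_polygons_fill:
  assumes "polygonal_domain T1" "polygonal_domain T2" "T1 \<inter> T2 = {}"
    and "a \<noteq> b" "n \<bullet> (b - a) = 0" "norm n = 1"
    and "open_segment a b \<subseteq> frontier T1 \<inter> frontier T2"
  shows "\<exists>x\<in>open_segment a b. \<exists>r>0. \<forall>y\<in>ball x r. n \<bullet> (y - x) \<noteq> 0 \<longrightarrow> y \<in> T1 \<union> T2"
proof -
  let ?bad = "\<lambda>T n. {x \<in> open_segment a b. \<not> germ_decided T (side_germ n x)}"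
  have m: "(-n) \<bullet> (b - a) = 0" "norm (-n) = 1" using assms(5,6) by auto
  have "finite (?bad T1 n \<union> ?bad T1 (-n) \<union> ?bad T2 n \<union> ?bad T2 (-n))"
    using polygon_decided_off_finite[OF assms(4-6)] polygon_decided_off_finite[OF assms(4) m] assms(1,2)
    by blast
  moreover have "infinite (open_segment a b)" using assms(4) by simp
  ultimately have "\<not> open_segment a b \<subseteq> ?bad T1 n \<union> ?bad T1 (-n) \<union> ?bad T2 n \<union> ?bad T2 (-n)"
    using finite_subset by blast
  then obtain x where x: "x \<in> open_segment a b"
    and dec: "germ_decided T1 (side_germ n x)" "germ_decided T1 (side_germ (-n) x)"
      "germ_decided T2 (side_germ n x)" "germ_decided T2 (side_germ (-n) x)"
    by blast
  have cl: "x \<in> closure T1" "x \<in> closure T2" using x assms(7) by (auto simp: frontier_def)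
  have not_both: "\<not> ((\<forall>\<^sub>F y in side_germ \<nu> x. y \<in> T1) \<and> (\<forall>\<^sub>F y in side_germ \<nu> x. y \<in> T2))"
    if \<nu>: "\<nu> \<in> {n, -n}" for \<nu>
  proof
    assume "(\<forall>\<^sub>F y in side_germ \<nu> x. y \<in> T1) \<and> (\<forall>\<^sub>F y in side_germ \<nu> x. y \<in> T2)"
    then obtain r s where r: "r > 0" "\<forall>y\<in>ball x r. 0 < \<nu> \<bullet> (y - x) \<longrightarrow> y \<in> T1"
      and s: "s > 0" "\<forall>y\<in>ball x s. 0 < \<nu> \<bullet> (y - x) \<longrightarrow> y \<in> T2"
      unfolding eventually_side_germ by blast
    have n1: "norm \<nu> = 1" using \<nu> assms(6) by auto
    define y where "y = x + (min r s / 2) *\<^sub>R \<nu>"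
    have "y \<in> ball x r" "y \<in> ball x s" "0 < \<nu> \<bullet> (y - x)"
      using r(1) s(1) n1 by (auto simp: y_def dist_norm dot_square_norm)
    then show False using r s assms(3) by blast
  qed
  have "((\<forall>\<^sub>F y in side_germ n x. y \<in> T1) \<or> (\<forall>\<^sub>F y in side_germ n x. y \<in> T2)) \<and>
    ((\<forall>\<^sub>F y in side_germ (-n) x. y \<in> T1) \<or> (\<forall>\<^sub>F y in side_germ (-n) x. y \<in> T2))"
    using not_both[of n] not_both[of "-n"]
      decided_frontier_half[OF polygon_open[OF assms(1)] cl(1) assms(6) dec(1,2)]
      decided_frontier_half[OF polygon_open[OF assms(2)] cl(2) assms(6) dec(3,4)] by blast
  then have "(\<forall>\<^sub>F y in side_germ n x. y \<in> T1 \<union> T2) \<and> (\<forall>\<^sub>F y in side_germ (-n) x. y \<in> T1 \<union> T2)"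
    by (auto elim: eventually_mono)
  then obtain r s where r: "r > 0" "\<forall>y\<in>ball x r. 0 < n \<bullet> (y - x) \<longrightarrow> y \<in> T1 \<union> T2"
    and s: "s > 0" "\<forall>y\<in>ball x s. 0 < (-n) \<bullet> (y - x) \<longrightarrow> y \<in> T1 \<union> T2"
    unfolding eventually_side_germ by blast
  have "\<forall>y\<in>ball x (min r s). n \<bullet> (y - x) \<noteq> 0 \<longrightarrow> y \<in> T1 \<union> T2"
    using r(2) s(2) by (force simp: neq_iff)
  then show ?thesis using x r(1) s(1) by (intro bexI[of _ x] exI[of _ "min r s"]) auto
qed

lemma chain_path_ends:
  "pathstart (chain_path p qs) = p" "pathfinish (chain_path p qs) = last (p # qs)"
  by (induction p qs rule: chain_path.induct) auto

text \<open>
  The part of the Jordan curve theorem that is needed: a simple closed chain is homeomorphic to a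
  circle, so every component of its complement has the whole chain as its frontier.
\<close>

lemma frontier_component_simple_closed_chain:
  assumes "simple_closed_chain \<Gamma>" "C \<in> components (- \<Gamma>)"
  shows "frontier C = \<Gamma>"
proof -
  obtain p ps where g: "simple_path (chain_path p (ps @ [p]))" "\<Gamma> = path_image (chain_path p (ps @ [p]))"
    using assms(1) unfolding simple_closed_chain_def by blast
  have "\<Gamma> homeomorphic sphere (0::complex) 1"
    unfolding g(2) by (rule homeomorphic_simple_path_image_circle) (use g in \<open>auto simp: chain_path_ends\<close>)
  moreover have "sphere (0::complex) 1 homeomorphic sphere (0::point) 1"
    by (rule homeomorphic_spheres_gen) auto
  ultimately show ?thesis
    using Jordan_Brouwer_frontier assms(2) homeomorphic_trans by fastforce
qed

lemma simple_closed_chain_subset_closure: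
  assumes "simple_closed_chain \<Gamma>"
  shows "inside \<Gamma> \<noteq> {} \<Longrightarrow> \<Gamma> \<subseteq> closure (inside \<Gamma>)" "outside \<Gamma> \<noteq> {} \<Longrightarrow> \<Gamma> \<subseteq> closure (outside \<Gamma>)"
proof -
  have *: "\<Gamma> \<subseteq> closure A"
    if "x \<in> A" "x \<notin> \<Gamma>" "\<And>y. connected_component (- \<Gamma>) x y \<Longrightarrow> y \<in> A" for x A
  proof -
    let ?C = "connected_component_set (- \<Gamma>) x"
    have "frontier ?C = \<Gamma>"
      using that by (intro frontier_component_simple_closed_chain[OF assms]) (auto simp: components_def)
    moreover have "?C \<subseteq> A" using that(3) by auto
    ultimately show ?thesis using closure_mono[of ?C A] by (auto simp: frontier_def)
  qed
  show "inside \<Gamma> \<noteq> {} \<Longrightarrow> \<Gamma> \<subseteq> closure (inside \<Gamma>)"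
    using * inside_same_component inside_no_overlap by (metis disjoint_iff ex_in_conv)
  show "outside \<Gamma> \<noteq> {} \<Longrightarrow> \<Gamma> \<subseteq> closure (outside \<Gamma>)"
    using * outside_same_component outside_no_overlap by (metis disjoint_iff ex_in_conv)
qed

section \<open>Elements adjacent to the interface\<close>

locale fitted_mesh =
  fixes M :: interface_mesh
  assumes setting: "interface_setting M" and mesh: "polygonal_mesh M" and fitted: "interface_fitted M"
begin

lemma
  shows finite_elements: "finite (elements M)"
    and elements_polygonal: "\<forall>T\<in>elements M. polygonal_domain T"
    and elements_pairwise: "pairwise disjnt (elements M)"
    and elements_cover: "(\<Union>T\<in>elements M. closure T) = closure (domain M)"
    and finite_edges: "finite (edges M)"
    and edges_straight: "\<forall>E\<in>edges M. straight_edge E"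
    and edges_cover: "(\<Union>E\<in>edges M. closure E) = (\<Union>T\<in>elements M. frontier T)"
    and edges_shared: "\<forall>E\<in>edges M.
        (\<exists>T1\<in>elements M. \<exists>T2\<in>elements M. T1 \<noteq> T2 \<and> E \<subseteq> frontier T1 \<inter> frontier T2) \<or>
        (\<exists>T\<in>elements M. E \<subseteq> frontier T \<inter> frontier (domain M))"
    and edges_normal: "\<forall>E\<in>edges M. norm (normal M E) = 1 \<and>
        (\<forall>x\<in>E. \<forall>y\<in>E. (y - x) \<bullet> normal M E = 0)"
  using mesh unfolding polygonal_mesh_def by - ((elim conjE, assumption)+)

lemma
  shows domain_polygonal: "polygonal_domain (domain M)"
    and interface_chain: "simple_closed_chain (interface M)"
    and interface_subset_domain: "interface M \<subseteq> domain M"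
    and interface_off_boundary: "interface M \<inter> frontier (domain M) = {}"
    and subdomain_polygonal: "\<forall>s. polygonal_domain (subdomain M s)"
    and diffusion_pos: "\<forall>s. diffusion M s > 0"
  using setting unfolding interface_setting_def by - ((elim conjE, assumption)+)

lemma element_polygon: "T \<in> elements M \<Longrightarrow> polygonal_domain T"
  using elements_polygonal by blast

lemma elements_disjoint: "T \<in> elements M \<Longrightarrow> T' \<in> elements M \<Longrightarrow> T \<noteq> T' \<Longrightarrow> T \<inter> T' = {}"
  using elements_pairwise unfolding pairwise_def disjnt_def by blast

lemma finite_edges_of: "finite (edges_of M T)"
  using finite_edges unfolding edges_of_def by auto

lemma interface_edges_subset: "interface_edges M \<subseteq> edges M"
  using fitted unfolding interface_fitted_def by blast

lemma edge_normal:
  assumes "E \<in> edges M"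
  shows "norm (normal M E) = 1" and "x \<in> E \<Longrightarrow> y \<in> E \<Longrightarrow> (y - x) \<bullet> normal M E = 0"
  using edges_normal assms by blast+

lemma edges_ofD:
  assumes "E \<in> edges_of M T"
  shows "E \<in> edges M" "E \<subseteq> frontier T" "closure E \<subseteq> closure T"
proof -
  show "E \<in> edges M" "E \<subseteq> frontier T" using assms unfolding edges_of_def by auto
  then show "closure E \<subseteq> closure T"
    by (intro closure_minimal) (auto simp: frontier_def)
qed

lemma element_subset_domain:
  assumes "T \<in> elements M" shows "T \<subseteq> domain M"
proof -
  have "T \<subseteq> closure (domain M)"
    using assms closure_subset elements_cover by blast
  then have "T \<subseteq> interior (closure (domain M))"
    using polygon_open[OF element_polygon[OF assms]] by (simp add: interior_maximal)
  then show ?thesis using polygon_interior_closure[OF domain_polygonal] by simp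
qed

lemma element_frontier_disjoint:
  assumes "T \<in> elements M" "T' \<in> elements M" shows "T \<inter> frontier T' = {}"
proof (cases "T = T'")
  case True
  then show ?thesis using polygon_open[OF element_polygon[OF assms(1)]]
    by (auto simp: frontier_def interior_open)
next
  case False
  then show ?thesis
    using elements_disjoint[OF assms] polygon_open[OF element_polygon[OF assms(1)]]
      open_Int_closure_eq_empty[of T T'] by (auto simp: frontier_def)
qed

lemma interface_eq: "interface M = (\<Union>E\<in>interface_edges M. closure E)"
  using fitted unfolding interface_fitted_def by blast

lemma element_interface_disjoint:
  assumes "T \<in> elements M" shows "T \<inter> interface M = {}"
proof -
  have "interface M \<subseteq> (\<Union>E\<in>edges M. closure E)"
    using interface_edges_subset interface_eq by blast
  also have "\<dots> = (\<Union>T\<in>elements M. frontier T)"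
    by (rule edges_cover)
  finally show ?thesis using element_frontier_disjoint[OF assms] by blast
qed

lemma subdomains_disjoint: "subdomain M Internal \<inter> subdomain M External = {}"
  unfolding subdomain.simps using inside_Int_outside[of "interface M"] by blast

lemma elements_in_disjoint: "elements_in M Internal \<inter> elements_in M External = {}"
proof -
  have "T \<noteq> {}" if "T \<in> elements M" for T
    using polygonal_domain_nonempty[OF element_polygon[OF that]] .
  then show ?thesis using subdomains_disjoint unfolding elements_in_def by blast
qed

text \<open>
  A connected element avoiding the interface lies in a single component of the complement of
  the interface.
\<close>

lemma elements_eq_Un: "elements M = elements_in M Internal \<union> elements_in M External"
proof
  show "elements M \<subseteq> elements_in M Internal \<union> elements_in M External"
  proof
    fix T assume T: "T \<in> elements M"
    obtain x where x: "x \<in> T" using polygonal_domain_nonempty[OF element_polygon[OF T]] by blast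
    have con: "connected_component (- interface M) x y" if "y \<in> T" for y
      using element_interface_disjoint[OF T] polygonal_domain_connected[OF element_polygon[OF T]] x that
      unfolding connected_component_def by (intro exI[of _ T]) auto
    have "x \<in> inside (interface M) \<or> x \<in> outside (interface M)"
      using element_interface_disjoint[OF T] x inside_Un_outside[of "interface M"] by blast
    then have "T \<subseteq> inside (interface M) \<or> T \<subseteq> outside (interface M)"
      using inside_same_component outside_same_component con by (metis subsetI)
    then show "T \<in> elements_in M Internal \<union> elements_in M External"
      using element_subset_domain[OF T] T by (auto simp: elements_in_def)
  qed
qed (auto simp: elements_in_def)

lemma side_of_eq: "T \<in> elements_in M s \<Longrightarrow> side_of M T = s"
  using elements_in_disjoint by (cases s) (auto simp: side_of_def)

lemma in_elements_in_side_of: "T \<in> elements M \<Longrightarrow> T \<in> elements_in M (side_of M T)"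
  using elements_eq_Un by (auto simp: side_of_def)

lemma interface_in_subdomain_closure:
  assumes "x \<in> interface M" "open U" "x \<in> U"
  shows "open (subdomain M s \<inter> U)" "subdomain M s \<inter> U \<noteq> {}"
proof -
  have op: "open (subdomain M s)" and ne: "subdomain M s \<noteq> {}" for s
    using polygon_open polygonal_domain_nonempty subdomain_polygonal by blast+
  show "open (subdomain M s \<inter> U)" using op assms(2) by blast
  have dom: "open (domain M)" using polygon_open[OF domain_polygonal] .
  have dom_x: "x \<in> domain M" using assms(1) interface_subset_domain by blast
  have cl: "A \<inter> (domain M \<inter> U) \<noteq> {}" if "x \<in> closure A" for A
    using that open_Int_closure_eq_empty[of "domain M \<inter> U" A] dom assms(2,3) dom_x by blast
  show "subdomain M s \<inter> U \<noteq> {}"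
  proof (cases s)
    case Internal
    have "inside (interface M) \<noteq> {}" using ne[of Internal] by auto
    then have "x \<in> closure (inside (interface M))"
      using simple_closed_chain_subset_closure(1)[OF interface_chain] assms(1) by blast
    then show ?thesis using cl Internal by (auto simp: Int_ac)
  next
    case External
    have "outside (interface M) \<noteq> {}" using ne[of External] by auto
    then have "x \<in> closure (outside (interface M))"
      using simple_closed_chain_subset_closure(2)[OF interface_chain] assms(1) by blast
    then show ?thesis using cl External by (auto simp: Int_ac)
  qed
qed

text \<open>
  Two elements share the edge and together fill a neighbourhood of one of its points, up to the
  line carrying the edge.  Both subdomains reach into this neighbourhood, so one element lies
  on each side; a third element adjacent to the edge would have to meet one of the two.
\<close>

lemma interface_edge_neighbours:
  assumes "E \<in> interface_edges M"
  shows "\<exists>!T. T \<in> elements_in M s \<and> E \<in> edges_of M T"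
proof -
  have E: "E \<in> edges M" using assms interface_edges_subset by blast
  obtain a b where ab: "a \<noteq> b" "E = open_segment a b"
    using edges_straight E unfolding straight_edge_def by blast
  define n where "n = normal M E"
  have n: "norm n = 1" using edge_normal(1)[OF E] n_def by blast
  have E_int: "E \<subseteq> interface M" using interface_eq assms closure_subset by blast
  have perp: "n \<bullet> (b - a) = 0"
  proof -
    have 1: "a + t *\<^sub>R (b - a) \<in> E" if "0 < t" "t < 1" for t
      unfolding ab(2) in_segment using that ab(1) by (intro conjI exI[of _ t]) (simp_all add: algebra_simps)
    \<comment> \<open>The normal is only known to be orthogonal to differences of points of the open edge.\<close>
    have "((a + (2/3) *\<^sub>R (b - a)) - (a + (1/3) *\<^sub>R (b - a))) \<bullet> n = 0"
      unfolding n_def by (rule edge_normal(2)[OF E 1 1]) simp_all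
    moreover have "(a + (2/3) *\<^sub>R (b - a)) - (a + (1/3) *\<^sub>R (b - a)) = (2/3 - 1/3) *\<^sub>R (b - a)"
      by (simp only: scaleR_left_diff_distrib add_diff_cancel_left)
    ultimately have "((2/3 - 1/3) *\<^sub>R (b - a)) \<bullet> n = 0" by (simp only:)
    then have "(2/3 - 1/3 :: real) * (n \<bullet> (b - a)) = 0" by (simp only: inner_scaleR_left inner_commute[of n])
    then show ?thesis by simp
  qed
  have "E \<noteq> {}" using ab by simp
  then have "\<not> E \<subseteq> frontier (domain M)"
    using E_int interface_off_boundary by blast
  then obtain T1 T2 where T: "T1 \<in> elements M" "T2 \<in> elements M" "T1 \<noteq> T2"
    and fr: "E \<subseteq> frontier T1 \<inter> frontier T2"
    using edges_shared E by blast
  have "\<exists>x\<in>E. \<exists>r>0. \<forall>y\<in>ball x r. n \<bullet> (y - x) \<noteq> 0 \<longrightarrow> y \<in> T1 \<union> T2"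
    using adjacent_polygons_fill[OF element_polygon[OF T(1)] element_polygon[OF T(2)]
        elements_disjoint[OF T] ab(1) perp n] fr unfolding ab(2) .
  then obtain x r where x: "x \<in> E" "r > 0" "\<forall>y\<in>ball x r. n \<bullet> (y - x) \<noteq> 0 \<longrightarrow> y \<in> T1 \<union> T2"
    by (elim bexE exE conjE)
  \<comment> \<open>Open sets are never contained in the line carrying the edge.\<close>
  have hits: "\<exists>y\<in>U. y \<in> T1 \<union> T2" if "open (U \<inter> ball x r)" "U \<inter> ball x r \<noteq> {}" for U
    using open_meets_off_line[OF that n, of x] x(3) by blast
  have side: "\<exists>T\<in>{T1, T2}. T \<in> elements_in M s" for s
  proof -
    obtain y where y: "y \<in> subdomain M s" "y \<in> T1 \<union> T2"
      using hits[OF interface_in_subdomain_closure[of x "ball x r" s]] x(1,2) E_int by auto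
    then obtain T where T': "T \<in> {T1, T2}" "y \<in> T" by blast
    then have "T \<in> elements M" using T by blast
    then obtain s' where s': "T \<in> elements_in M s'" using elements_eq_Un by blast
    then have "y \<in> subdomain M s'" using T'(2) unfolding elements_in_def by blast
    then have "s' = s" using y(1) subdomains_disjoint by (cases s; cases s') auto
    then show ?thesis using T' s' by blast
  qed
  have only: "T \<in> {T1, T2}" if T3: "T \<in> elements M" "E \<subseteq> frontier T" for T
  proof -
    have "x \<in> closure T" using T3(2) x(1) by (auto simp: frontier_def)
    then have "open (T \<inter> ball x r)" "T \<inter> ball x r \<noteq> {}"
      using frontier_open_meets[of T x "ball x r"] polygon_open[OF element_polygon[OF T3(1)]] x(2) by auto
    then obtain y where "y \<in> T" "y \<in> T1 \<union> T2" using hits by blast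
    then show ?thesis using elements_disjoint[OF T3(1) T(1)] elements_disjoint[OF T3(1) T(2)] by blast
  qed
  have one: "\<not> (T1 \<in> elements_in M s \<and> T2 \<in> elements_in M s)" for s
  proof
    assume *: "T1 \<in> elements_in M s \<and> T2 \<in> elements_in M s"
    define s' where "s' = (if s = Internal then External else Internal)"
    obtain T where "T \<in> {T1, T2}" "T \<in> elements_in M s'" using side by blast
    then have "side_of M T = s" "side_of M T = s'" using * side_of_eq by auto
    then show False unfolding s'_def by (auto split: if_splits)
  qed
  obtain T where T': "T \<in> {T1, T2}" "T \<in> elements_in M s" using side by blast
  show ?thesis
  proof (rule ex1I[of _ T])
    show "T \<in> elements_in M s \<and> E \<in> edges_of M T" using T' fr E by (auto simp: edges_of_def)
    fix T3 assume "T3 \<in> elements_in M s \<and> E \<in> edges_of M T3"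
    then have "T3 \<in> {T1, T2}" "T3 \<in> elements_in M s"
      using only by (auto simp: elements_in_def edges_of_def)
    then show "T3 = T" using T' one by blast
  qed
qed

lemma element_at:
  assumes "E \<in> interface_edges M"
  shows "element_at M s E \<in> elements_in M s" "E \<in> edges_of M (element_at M s E)"
  using theI'[OF interface_edge_neighbours[OF assms, of s]] unfolding element_at_def by auto

end

section \<open>Coercivity\<close>

lemma (in edge) diameter_pos: "0 < diameter E"
proof -
  have "par (1/3) \<in> E" "par (2/3) \<in> E" by (intro par_in_open; simp)+
  moreover have "bounded E"
    unfolding seg by (rule bounded_subset[OF bounded_closed_segment segment_open_subset_closed])
  ultimately have "dist (par (1/3)) (par (2/3)) \<le> diameter E"
    by (rule diameter_bounded_bound[rotated])
  moreover have "par (1/3) \<noteq> par (2/3)" using coord_par[of "1/3"] coord_par[of "2/3"] by force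
  ultimately show ?thesis by (meson dual_order.strict_trans1 zero_less_dist_iff)
qed

lemma element_norm_sq: "(element_norm T f)\<^sup>2 = element_integral T (\<lambda>x. (norm (f x))\<^sup>2)"
  unfolding element_norm_def by (simp add: element_integral_nonneg)

lemma (in edge) edge_norm_sq: "(edge_norm E f)\<^sup>2 = edge_integral E (\<lambda>x. (norm (f x))\<^sup>2)"
  unfolding edge_norm_def by (simp add: integral_nonneg)

text \<open>
  Young's inequality \<open>2 p q \<le> p\<^sup>2 + q\<^sup>2\<close> under the square roots hidden in the first two assumptions.
  The weights are chosen such that \<open>N\<close> interface edges per element cost \<open>\<epsilon>\<close> times the gradient part.
\<close>

lemma young_flux_jump:
  fixes X A B g C h \<alpha> \<epsilon> N :: real
  assumes "X\<^sup>2 \<le> A * B" "A \<le> 2 * (C\<^sup>2 / h * g)"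
    and "0 \<le> B" "0 \<le> g" "0 < h" "0 < \<alpha>" "0 < \<epsilon>" "0 < N"
  shows "\<alpha> / 2 * X \<le> \<epsilon> / N * (\<alpha> / 2 * g) + C\<^sup>2 * N / (4 * \<epsilon>) * (\<alpha> / h * B)"
proof (rule power2_le_imp_le)
  let ?p = "\<epsilon> / N * (\<alpha> / 2 * g)" and ?q = "C\<^sup>2 * N / (4 * \<epsilon>) * (\<alpha> / h * B)"
  have "(\<alpha> / 2 * X)\<^sup>2 = \<alpha>\<^sup>2 / 4 * X\<^sup>2" by (simp add: power_mult_distrib power_divide)
  also have "\<dots> \<le> \<alpha>\<^sup>2 / 4 * (2 * (C\<^sup>2 / h * g) * B)"
    using assms(1) mult_right_mono[OF assms(2,3)] by (intro mult_left_mono) auto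
  also have "\<dots> = 4 * (?p * ?q)"
    using assms(5,7,8) by (simp add: field_simps power2_eq_square)
  also have "\<dots> \<le> (?p + ?q)\<^sup>2"
    using zero_le_power2[of "?p - ?q"] unfolding power2_sum power2_diff by linarith
  finally show "(\<alpha> / 2 * X)\<^sup>2 \<le> (?p + ?q)\<^sup>2" .
  show "0 \<le> ?p + ?q" using assms by simp
qed

locale discrete_function = fitted_mesh +
  fixes k :: nat and v :: "dofs \<times> dofs"
  assumes in_space: "v \<in> discrete_space M k"
begin

lemma element_locale:
  assumes "T \<in> elements M" shows "element T"
  using polygon_open polygon_bounded element_polygon[OF assms] by unfold_locales blast+

lemma edge_locale:
  assumes "E \<in> edges M" obtains a b where "edge E a b"
  using edges_straight assms straight_edgeE by blast

lemma local_dofs_in_space: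
  assumes "T \<in> elements M" shows "local_dofs M v T \<in> side_space M k (side_of M T)"
  using in_space unfolding local_dofs_def discrete_space_def
  by (cases "side_of M T") (auto simp: mem_Times_iff)

lemma local_dofs_in_polys:
  assumes T: "T \<in> elements M"
  shows "elem_dof (local_dofs M v T) T \<in> polys_on (int k - 1) T"
    and "E \<in> edges_of M T \<Longrightarrow> edge_dof (local_dofs M v T) E \<in> polys_on (int k - 1) E"
proof -
  have side: "T \<in> elements_in M (side_of M T)" by (rule in_elements_in_side_of[OF T])
  have dofs: "elem_dof (local_dofs M v T) \<in> (\<Pi>\<^sub>E T\<in>elements_in M (side_of M T). polys_on (int k - 1) T)"
    "edge_dof (local_dofs M v T) \<in> (\<Pi>\<^sub>E E\<in>edges_in M (side_of M T). polys_on (int k - 1) E)"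
    using local_dofs_in_space[OF T] unfolding side_space_def by auto
  show "elem_dof (local_dofs M v T) T \<in> polys_on (int k - 1) T" by (rule PiE_mem[OF dofs(1) side])
  assume "E \<in> edges_of M T"
  then have "E \<in> edges_in M (side_of M T)" using side unfolding edges_in_def by blast
  then show "edge_dof (local_dofs M v T) E \<in> polys_on (int k - 1) E" by (rule PiE_mem[OF dofs(2)])
qed

lemma edge_rec_poly:
  assumes "T \<in> elements M" "E \<in> edges_of M T"
  shows "edge_rec k E (local_dofs M v T) \<in> polys_on (int k + 1) E"
proof -
  obtain a b where "edge E a b" using edge_locale[OF edges_ofD(1)[OF assms(2)]] .
  then show ?thesis by (rule edge.edge_rec_in_polys) (rule local_dofs_in_polys(2)[OF assms])
qed

lemma broken_gradient_poly:
  assumes "T \<in> elements M" shows "broken_gradient M k v T \<in> vector_polys_on (int k) T"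
  unfolding broken_gradient_def
  by (rule element.gradient_rec_in_polys[OF element_locale[OF assms]])
     (use local_dofs_in_polys[OF assms] edges_ofD edges_straight in blast)+

abbreviation grad_sq :: "point set \<Rightarrow> real" where
  "grad_sq T \<equiv> element_integral T (\<lambda>x. (norm (broken_gradient M k v T x))\<^sup>2)"

text \<open>
  The trace constant is stated for scalar polynomials; it is applied to the normal component, whose
  \<open>L\<^sup>2\<close> norm is at most that of the whole gradient.
\<close>

lemma normal_trace_bound:
  assumes C: "discrete_trace_constant M k C" and T: "T \<in> elements M" and E: "E \<in> edges_of M T"
    and n: "norm n = 1"
  shows "edge_integral E (\<lambda>x. (broken_gradient M k v T x \<bullet> n)\<^sup>2) \<le> C\<^sup>2 / diameter E * grad_sq T"
proof -
  obtain a b where "edge E a b" using edge_locale[OF edges_ofD(1)[OF E]] .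
  then interpret E: edge E a b .
  interpret T: element T by (rule element_locale[OF T])
  let ?G = "broken_gradient M k v T"
  let ?\<phi> = "\<lambda>x. ?G x \<bullet> n"
  note G = broken_gradient_poly[OF T]
  have h: "0 < diameter E" by (rule E.diameter_pos)
  have \<phi>: "?\<phi> \<in> polys_on (int k) T" by (rule vector_polys_on_inner[OF G])
  have "edge_norm E ?\<phi> \<le> C * diameter E powr (-1/2) * element_norm T ?\<phi>"
    using C T E \<phi> unfolding discrete_trace_constant_def by blast
  moreover have "0 \<le> edge_norm E ?\<phi>" unfolding edge_norm_def by (simp add: E.integral_nonneg)
  ultimately have "(edge_norm E ?\<phi>)\<^sup>2 \<le> (C * diameter E powr (-1/2) * element_norm T ?\<phi>)\<^sup>2"
    by (rule power_mono)
  also have "\<dots> = C\<^sup>2 / diameter E * (element_norm T ?\<phi>)\<^sup>2"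
  proof -
    have "(diameter E powr (-1/2))\<^sup>2 = 1 / diameter E"
      using h by (simp add: powr_minus_divide powr_half_sqrt power_divide)
    then show ?thesis by (simp add: power_mult_distrib)
  qed
  also have "\<dots> \<le> C\<^sup>2 / diameter E * grad_sq T"
  proof (rule mult_left_mono)
    have "(?\<phi> x)\<^sup>2 \<le> (norm (?G x))\<^sup>2" for x
      using Cauchy_Schwarz_ineq2[of "?G x" n] n by (simp add: abs_le_square_iff[symmetric])
    then show "(element_norm T ?\<phi>)\<^sup>2 \<le> grad_sq T"
      unfolding element_norm_sq real_norm_def power2_abs
      using vector_polys_on_continuous[OF G subset_refl]
      by (intro T.integral_mono continuous_intros)
    show "0 \<le> C\<^sup>2 / diameter E" using h by simp
  qed
  finally show ?thesis unfolding E.edge_norm_sq by simp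
qed

lemma harmonic_mean_half_le: "harmonic_mean M / 2 \<le> diffusion M s" "0 < harmonic_mean M"
proof -
  have p: "0 < diffusion M Internal" "0 < diffusion M External" using diffusion_pos by blast+
  then show "0 < harmonic_mean M" unfolding harmonic_mean_def by simp
  show "harmonic_mean M / 2 \<le> diffusion M s"
    unfolding harmonic_mean_def using p by (cases s) (auto simp: field_simps)
qed

text \<open>
  The weights of the average satisfy \<open>weight s * diffusion s = harmonic_mean / 2\<close> on both sides, so
  the averaged flux is half the harmonic mean times the sum of the two normal gradients.  After
  Cauchy--Schwarz and the trace bound, \<open>harmonic_mean / 2 \<le> diffusion s\<close> turns the harmonic mean back
  into the diffusion coefficient of each element.
\<close>

lemma interface_flux_bound:
  assumes C: "discrete_trace_constant M k C" and E: "E \<in> interface_edges M"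
    and "0 < \<epsilon>" "0 < N"
  shows "edge_integral E (\<lambda>x.
          (average M (\<lambda>T y. elem_diffusion M T *\<^sub>R broken_gradient M k v T y) E x \<bullet> normal M E)
          * jump M k v E x)
    \<le> \<epsilon> / N * (\<Sum>s\<in>{Internal, External}. diffusion M s * grad_sq (element_at M s E))
      + C\<^sup>2 * N / (4 * \<epsilon>) * (harmonic_mean M / diameter E * edge_integral E (\<lambda>x. (jump M k v E x)\<^sup>2))"
proof -
  have E': "E \<in> edges M" using E interface_edges_subset by blast
  obtain a b where "edge E a b" using edge_locale[OF E'] .
  then interpret E: edge E a b .
  let ?T = "\<lambda>s. element_at M s E" and ?j = "jump M k v E" and ?n = "normal M E"
  let ?\<phi> = "\<lambda>s x. broken_gradient M k v (?T s) x \<bullet> ?n"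
  have T: "?T s \<in> elements M" "E \<in> edges_of M (?T s)" "elem_diffusion M (?T s) = diffusion M s" for s
    using element_at[OF E] side_of_eq[OF element_at(1)[OF E]]
    by (auto simp: elements_in_def elem_diffusion_def)
  have n: "norm ?n = 1" by (rule edge_normal(1)[OF E'])
  have j: "continuous_on (closure E) ?j"
    unfolding jump_def by (intro continuous_on_diff polys_on_continuous[OF edge_rec_poly[OF T(1,2)]] subset_refl)
  have \<phi>: "continuous_on (closure E) (?\<phi> s)" for s
    by (intro continuous_on_inner continuous_on_const
        vector_polys_on_continuous[OF broken_gradient_poly[OF T(1)]] edges_ofD(3)[OF T(2)])
  have weighted: "weight M s * diffusion M s = harmonic_mean M / 2" for s
    using diffusion_pos[rule_format, of Internal] diffusion_pos[rule_format, of External]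
    by (cases s) (simp_all add: harmonic_mean_def field_simps)
  let ?X = "edge_integral E (\<lambda>x. (?\<phi> Internal x + ?\<phi> External x) * ?j x)"
    and ?A = "edge_integral E (\<lambda>x. (?\<phi> Internal x + ?\<phi> External x)\<^sup>2)"
    and ?B = "edge_integral E (\<lambda>x. (?j x)\<^sup>2)"
    and ?g = "grad_sq (?T Internal) + grad_sq (?T External)"
  have "edge_integral E (\<lambda>x. (average M (\<lambda>T y. elem_diffusion M T *\<^sub>R broken_gradient M k v T y) E x \<bullet> ?n) * ?j x)
    = edge_integral E (\<lambda>x. harmonic_mean M / 2 * ((?\<phi> Internal x + ?\<phi> External x) * ?j x))"
    unfolding average_def T(3) scaleR_scaleR weighted inner_add_left inner_scaleR_left
    by (simp add: algebra_simps)
  also have "\<dots> = harmonic_mean M / 2 * ?X" by (rule edge_integral_cmul)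
  also have "\<dots> \<le> \<epsilon> / N * (harmonic_mean M / 2 * ?g)
      + C\<^sup>2 * N / (4 * \<epsilon>) * (harmonic_mean M / diameter E * ?B)"
  proof (rule young_flux_jump)
    show "?X\<^sup>2 \<le> ?A * ?B" using \<phi> j by (intro E.integral_Cauchy_Schwarz continuous_on_add)
    have "0 \<le> edge_integral E (\<lambda>x. (?\<phi> Internal x - ?\<phi> External x)\<^sup>2)"
      by (intro E.integral_nonneg) simp
    \<comment> \<open>The parallelogram identity stands for \<open>(u + w)\<^sup>2 \<le> 2 u\<^sup>2 + 2 w\<^sup>2\<close> under the integral.\<close>
    have "?A + edge_integral E (\<lambda>x. (?\<phi> Internal x - ?\<phi> External x)\<^sup>2)
      = edge_integral E (\<lambda>x. (?\<phi> Internal x + ?\<phi> External x)\<^sup>2 + 1 * (?\<phi> Internal x - ?\<phi> External x)\<^sup>2)"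
      by (subst E.integral_axpy) (auto intro!: continuous_on_power continuous_on_add continuous_on_diff \<phi>)
    also have "\<dots> = edge_integral E (\<lambda>x. 2 * ((?\<phi> Internal x)\<^sup>2 + 1 * (?\<phi> External x)\<^sup>2))"
      by (intro E.integral_cong) (simp add: power2_eq_square algebra_simps)
    also have "\<dots> = 2 * edge_integral E (\<lambda>x. (?\<phi> Internal x)\<^sup>2 + 1 * (?\<phi> External x)\<^sup>2)"
      by (rule edge_integral_cmul)
    also have "edge_integral E (\<lambda>x. (?\<phi> Internal x)\<^sup>2 + 1 * (?\<phi> External x)\<^sup>2)
      = edge_integral E (\<lambda>x. (?\<phi> Internal x)\<^sup>2) + 1 * edge_integral E (\<lambda>x. (?\<phi> External x)\<^sup>2)"
      by (intro E.integral_axpy continuous_on_power \<phi>)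
    also have "2 * (edge_integral E (\<lambda>x. (?\<phi> Internal x)\<^sup>2) + 1 * edge_integral E (\<lambda>x. (?\<phi> External x)\<^sup>2))
      \<le> 2 * (C\<^sup>2 / diameter E * ?g)"
      using normal_trace_bound[OF C T(1,2) n, of Internal] normal_trace_bound[OF C T(1,2) n, of External]
      by (simp add: distrib_left)
    finally show "?A \<le> 2 * (C\<^sup>2 / diameter E * ?g)"
      using \<open>0 \<le> edge_integral E (\<lambda>x. (?\<phi> Internal x - ?\<phi> External x)\<^sup>2)\<close> by linarith
    show "0 \<le> ?B" by (intro E.integral_nonneg) simp
    show "0 \<le> ?g" by (intro add_nonneg_nonneg element_integral_nonneg) auto
  qed (use E.diameter_pos harmonic_mean_half_le(2) assms(3,4) in auto)
  also have "\<epsilon> / N * (harmonic_mean M / 2 * ?g)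
    \<le> \<epsilon> / N * (\<Sum>s\<in>{Internal, External}. diffusion M s * grad_sq (?T s))"
  proof (rule mult_left_mono)
    have "harmonic_mean M / 2 * grad_sq (?T s) \<le> diffusion M s * grad_sq (?T s)" for s
      by (intro mult_right_mono harmonic_mean_half_le(1) element_integral_nonneg) auto
    from add_mono[OF this[of Internal] this[of External]]
    show "harmonic_mean M / 2 * ?g \<le> (\<Sum>s\<in>{Internal, External}. diffusion M s * grad_sq (?T s))"
      by (simp add: distrib_left)
    show "0 \<le> \<epsilon> / N" using assms(3,4) by simp
  qed
  finally show ?thesis by simp
qed

lemma card_interface_edges_le:
  assumes "T \<in> elements M"
  shows "card (edges_of M T \<inter> interface_edges M) \<le> max_interface_edges M"
  unfolding max_interface_edges_def using finite_elements assms by (intro Max_ge) auto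

text \<open>
  The edges whose neighbour on the side \<open>s\<close> is \<open>T\<close> are among the interface edges on the boundary of \<open>T\<close>.
\<close>

lemma sum_element_at_le:
  assumes f: "\<And>T. 0 \<le> f T"
  shows "(\<Sum>E\<in>interface_edges M. f (element_at M s E))
    \<le> real (max_interface_edges M) * (\<Sum>T\<in>elements_in M s. f T)"
proof -
  have fin: "finite (interface_edges M)" "finite (elements_in M s)"
    using finite_subset[OF interface_edges_subset finite_edges] finite_elements
    by (auto simp: elements_in_def)
  have "(\<Sum>E\<in>interface_edges M. f (element_at M s E))
    = (\<Sum>T\<in>elements_in M s. \<Sum>E\<in>{E \<in> interface_edges M. element_at M s E = T}. f (element_at M s E))"
    by (rule sum.group[symmetric]) (use fin element_at(1) in auto)
  also have "\<dots> = (\<Sum>T\<in>elements_in M s. real (card {E \<in> interface_edges M. element_at M s E = T}) * f T)"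
    by (intro sum.cong refl) simp
  also have "\<dots> \<le> (\<Sum>T\<in>elements_in M s. real (max_interface_edges M) * f T)"
  proof (intro sum_mono mult_right_mono f)
    fix T assume T: "T \<in> elements_in M s"
    have "card {E \<in> interface_edges M. element_at M s E = T} \<le> card (edges_of M T \<inter> interface_edges M)"
      by (rule card_mono) (use finite_edges_of element_at(2) in auto)
    also have "\<dots> \<le> max_interface_edges M"
      using T by (intro card_interface_edges_le) (simp add: elements_in_def)
    finally show "real (card {E \<in> interface_edges M. element_at M s E = T}) \<le> real (max_interface_edges M)"
      by simp
  qed
  finally show ?thesis by (simp add: sum_distrib_left)
qed

abbreviation broken_energy :: real where
  "broken_energy \<equiv> \<Sum>T\<in>elements M. elem_diffusion M T * grad_sq T"

abbreviation stabilisation :: real where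
  "stabilisation \<equiv> \<Sum>T\<in>elements M. elem_diffusion M T / diameter T *
     (\<Sum>E\<in>edges_of M T. edge_integral E (\<lambda>x. (residual M k v T E x)\<^sup>2))"

abbreviation jump_energy :: real where
  "jump_energy \<equiv> \<Sum>E\<in>interface_edges M.
     harmonic_mean M / diameter E * edge_integral E (\<lambda>x. (jump M k v E x)\<^sup>2)"

abbreviation consistency :: real where
  "consistency \<equiv> \<Sum>E\<in>interface_edges M. edge_integral E (\<lambda>x.
     (average M (\<lambda>T y. elem_diffusion M T *\<^sub>R broken_gradient M k v T y) E x \<bullet> normal M E)
     * jump M k v E x)"

text \<open>
  Summing the bound for a single edge gives \<open>\<epsilon> / N\<close> of the energy of each element for each of its
  at most \<open>N\<close> interface edges.  The division by \<open>N\<close> is the reason for treating an interface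
  without edges separately.
\<close>

lemma consistency_bound:
  assumes C: "discrete_trace_constant M k C" and \<epsilon>: "0 < \<epsilon>"
  shows "consistency \<le> \<epsilon> * broken_energy + C\<^sup>2 * real (max_interface_edges M) / (4 * \<epsilon>) * jump_energy"
proof (cases "interface_edges M = {}")
  case True
  have "0 \<le> broken_energy"
    using diffusion_pos by (intro sum_nonneg mult_nonneg_nonneg element_integral_nonneg)
      (auto simp: elem_diffusion_def less_imp_le)
  then show ?thesis using True \<epsilon> by simp
next
  case False
  let ?N = "real (max_interface_edges M)"
  obtain E where E: "E \<in> interface_edges M" using False by blast
  then have "E \<in> edges_of M (element_at M Internal E) \<inter> interface_edges M"
    using element_at(2) by blast
  then have "0 < card (edges_of M (element_at M Internal E) \<inter> interface_edges M)"
    using finite_edges_of by (auto simp: card_gt_0_iff)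
  then have N: "0 < ?N"
    using card_interface_edges_le[of "element_at M Internal E"] element_at(1)[OF E, of Internal]
    by (simp add: elements_in_def)
  have "consistency \<le> (\<Sum>E\<in>interface_edges M.
      \<epsilon> / ?N * (\<Sum>s\<in>{Internal, External}. diffusion M s * grad_sq (element_at M s E))
      + C\<^sup>2 * ?N / (4 * \<epsilon>) * (harmonic_mean M / diameter E * edge_integral E (\<lambda>x. (jump M k v E x)\<^sup>2)))"
    by (intro sum_mono interface_flux_bound[OF C _ \<epsilon> N])
  also have "\<dots> = \<epsilon> / ?N * (\<Sum>s\<in>{Internal, External}. \<Sum>E\<in>interface_edges M.
      diffusion M s * grad_sq (element_at M s E)) + C\<^sup>2 * ?N / (4 * \<epsilon>) * jump_energy"
    unfolding sum.distrib sum_distrib_left by (subst sum.swap) (rule refl)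
  also have "\<dots> \<le> \<epsilon> / ?N * (\<Sum>s\<in>{Internal, External}. ?N * (\<Sum>T\<in>elements_in M s. diffusion M s * grad_sq T))
      + C\<^sup>2 * ?N / (4 * \<epsilon>) * jump_energy"
  proof (intro add_right_mono mult_left_mono sum_mono)
    fix s
    have "0 \<le> diffusion M s * grad_sq T" for T
      using diffusion_pos by (intro mult_nonneg_nonneg element_integral_nonneg) (auto simp: less_imp_le)
    then show "(\<Sum>E\<in>interface_edges M. diffusion M s * grad_sq (element_at M s E))
        \<le> ?N * (\<Sum>T\<in>elements_in M s. diffusion M s * grad_sq T)"
      by (rule sum_element_at_le)
  qed (use \<epsilon> N in simp)
  also have "\<epsilon> / ?N * (\<Sum>s\<in>{Internal, External}. ?N * (\<Sum>T\<in>elements_in M s. diffusion M s * grad_sq T))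
      = \<epsilon> * broken_energy"
  proof -
    have "(\<Sum>T\<in>elements_in M s. diffusion M s * grad_sq T)
        = (\<Sum>T\<in>elements_in M s. elem_diffusion M T * grad_sq T)" for s
      by (intro sum.cong refl) (simp add: elem_diffusion_def side_of_eq)
    moreover have "finite (elements_in M s)" for s
      using finite_elements by (auto simp: elements_in_def)
    then have "broken_energy = (\<Sum>T\<in>elements_in M Internal. elem_diffusion M T * grad_sq T)
        + (\<Sum>T\<in>elements_in M External. elem_diffusion M T * grad_sq T)"
      unfolding elements_eq_Un using elements_in_disjoint by (intro sum.union_disjoint)
    ultimately show ?thesis using N by (simp add: sum_distrib_left[symmetric] algebra_simps)
  qed
  finally show ?thesis .
qed

lemma edge_square_nonneg:
  assumes "E \<in> edges M" shows "0 \<le> edge_integral E (\<lambda>x. (f x)\<^sup>2)"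
proof -
  obtain a b where "edge E a b" using edge_locale[OF assms] .
  then show ?thesis by (rule edge.integral_nonneg) simp
qed

lemma energies_nonneg: "0 \<le> broken_energy" "0 \<le> stabilisation" "0 \<le> jump_energy"
proof -
  have \<sigma>: "0 \<le> elem_diffusion M T" for T
    using diffusion_pos by (auto simp: elem_diffusion_def less_imp_le)
  show "0 \<le> broken_energy" by (intro sum_nonneg mult_nonneg_nonneg \<sigma> element_integral_nonneg) simp
  have "0 \<le> diameter X" if "bounded X" for X :: "point set" using that by (rule diameter_ge_0)
  then show "0 \<le> stabilisation"
    using polygon_bounded[OF element_polygon] edges_ofD(1)
    by (intro sum_nonneg mult_nonneg_nonneg divide_nonneg_nonneg \<sigma> edge_square_nonneg) auto
  have "0 < diameter E" if "E \<in> edges M" for E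
    using edge_locale[OF that] edge.diameter_pos by metis
  then show "0 \<le> jump_energy"
    using interface_edges_subset harmonic_mean_half_le(2)
    by (intro sum_nonneg mult_nonneg_nonneg divide_nonneg_nonneg edge_square_nonneg)
       (auto simp: less_imp_le subset_iff)
qed

lemma edge_norm_square:
  assumes "E \<in> edges M" shows "(edge_norm E f)\<^sup>2 = edge_integral E (\<lambda>x. (norm (f x))\<^sup>2)"
proof -
  obtain a b where "edge E a b" using edge_locale[OF assms] .
  then show ?thesis by (rule edge.edge_norm_sq)
qed

lemma jump_seminorm_square: "(jump_seminorm M k v)\<^sup>2 = jump_energy"
proof -
  have "(\<Sum>E\<in>interface_edges M. harmonic_mean M / diameter E * (edge_norm E (jump M k v E))\<^sup>2) = jump_energy"
    using interface_edges_subset by (intro sum.cong refl) (auto simp: edge_norm_square)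
  then show ?thesis unfolding jump_seminorm_def using energies_nonneg(3) by simp
qed

lemma energy_norm_square: "(energy_norm M k v)\<^sup>2 = broken_energy + stabilisation + jump_energy"
proof -
  have "(\<Sum>T\<in>elements M. elem_diffusion M T * ((element_norm T (broken_gradient M k v T))\<^sup>2
      + inverse (diameter T) * (\<Sum>E\<in>edges_of M T. (edge_norm E (residual M k v T E))\<^sup>2)))
    = broken_energy + stabilisation"
    unfolding sum.distrib[symmetric]
  proof (intro sum.cong refl)
    fix T assume "T \<in> elements M"
    have "(\<Sum>E\<in>edges_of M T. (edge_norm E (residual M k v T E))\<^sup>2)
      = (\<Sum>E\<in>edges_of M T. edge_integral E (\<lambda>x. (residual M k v T E x)\<^sup>2))"
      by (intro sum.cong refl) (simp add: edge_norm_square[OF edges_ofD(1)])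
    then show "elem_diffusion M T * ((element_norm T (broken_gradient M k v T))\<^sup>2
        + inverse (diameter T) * (\<Sum>E\<in>edges_of M T. (edge_norm E (residual M k v T E))\<^sup>2))
      = elem_diffusion M T * grad_sq T + elem_diffusion M T / diameter T *
        (\<Sum>E\<in>edges_of M T. edge_integral E (\<lambda>x. (residual M k v T E x)\<^sup>2))"
      by (simp add: element_norm_sq distrib_left divide_inverse)
  qed
  then show ?thesis
    unfolding energy_norm_def jump_seminorm_square using energies_nonneg by simp
qed

lemma bilinear_form_diagonal:
  "bilinear_form M k \<eta> v v = broken_energy + stabilisation - consistency + \<eta> * jump_energy"
  unfolding bilinear_form_def element_integral_cmul
  by (simp add: sum.distrib dot_square_norm power2_eq_square[symmetric])

end

text \<open>
  The three energies are compared separately: \<open>1 - \<epsilon>\<close> and \<open>\<eta> - C\<^sup>2 N / (4 \<epsilon>)\<close> are what the consistency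
  bound leaves of the gradient and jump parts, and the full stabilisation part is more than enough
  because \<open>1 - \<epsilon> \<le> 1\<close>.
\<close>

theorem lemma7:
  fixes M :: interface_mesh and k :: nat and \<rho> C\<^sub>t\<^sub>r \<eta> \<epsilon> :: real
  assumes "regular_interface_mesh M \<rho>"
    and "discrete_trace_constant M k C\<^sub>t\<^sub>r"
    and "0 < \<epsilon>" and "\<epsilon> < 1"
    and "\<eta> > C\<^sub>t\<^sub>r\<^sup>2 * real (max_interface_edges M) / (4 * \<epsilon>)"
  shows "\<forall>v\<in>discrete_space0 M k.
           min (1 - \<epsilon>) (\<eta> - C\<^sub>t\<^sub>r\<^sup>2 * real (max_interface_edges M) / (4 * \<epsilon>)) * (energy_norm M k v)\<^sup>2
             \<le> bilinear_form M k \<eta> v v"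
proof
  fix v assume "v \<in> discrete_space0 M k"
  then interpret discrete_function M k v
    using assms(1) by unfold_locales (auto simp: regular_interface_mesh_def discrete_space0_def)
  let ?c = "C\<^sub>t\<^sub>r\<^sup>2 * real (max_interface_edges M) / (4 * \<epsilon>)"
  let ?m = "min (1 - \<epsilon>) (\<eta> - ?c)"
  have "?m * (energy_norm M k v)\<^sup>2 = ?m * broken_energy + ?m * stabilisation + ?m * jump_energy"
    unfolding energy_norm_square by (simp add: distrib_left)
  also have "\<dots> \<le> (1 - \<epsilon>) * broken_energy + 1 * stabilisation + (\<eta> - ?c) * jump_energy"
    using energies_nonneg \<open>0 < \<epsilon>\<close> by (intro add_mono mult_right_mono) auto
  also have "\<dots> = broken_energy + stabilisation
      - (\<epsilon> * broken_energy + ?c * jump_energy) + \<eta> * jump_energy"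
    by (simp add: algebra_simps)
  also have "\<dots> \<le> bilinear_form M k \<eta> v v"
    unfolding bilinear_form_diagonal using consistency_bound[OF assms(2,3)] by simp
  finally show "?m * (energy_norm M k v)\<^sup>2 \<le> bilinear_form M k \<eta> v v" .
qed

end
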